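(* For an integer $n\ge 3$, let $H(n)$ be the number of equivalence classes of sign sequences of length $n$ that contain a sequence obtainable from $(1,1,1)$ by finitely many extensions. Then $$H(n) = \begin{cases} \displaystyle\sum_{i=0}^{\lfloor (n-2)/6 \rfloor} B\!\left(n, \lceil n/2 \rceil + 1 + 3i\right) & \text{for } n \text{ odd},\\[3mm] \displaystyle -\tfrac{1}{2}B(n,n/2) + \tfrac12 F(n) - 1 + \sum_{i=0}^{\lfloor n/6 \rfloor} B\!\left(n, \lceil n/2 \rceil + 3i\right) & \text{for } n \text{ even},\end{cases}$$ where, for even $n$, $$F(n) = \sum_{k=1}^{n/2} \ \sum_{l \mid \gcd(n/2,k)} L\!\left(\frac{n}{2l},\frac{k}{l}\right) \left\lceil \frac{k}{2l} \right\rceil .$$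
   Context: Hexaflexagons with $n$ faces are encoded by sign sequences $(a_1,\dots,a_n)\in\{1,-1\}^n$. The trihexaflexagon has sign sequence $(1,1,1)$. An extension of a sign sequence replaces some single entry $a_i$ (any position) by the consecutive pair $(-a_i,-a_i)$, producing a sequence of length one greater. Two sign sequences are equivalent if one can be transformed into the other by a combination of cyclic shifts $(a_1,\dots,a_n)\mapsto(a_i,\dots,a_n,a_1,\dots,a_{i-1})$, reversal $(a_1,\dots,a_n)\mapsto(a_n,\dots,a_1)$, and inversion $(a_1,\dots,a_n)\mapsto(-a_1,\dots,-a_n)$. Notation: $B(n,k)$ is the number of binary bracelets of length $n$ with $k$ ones, i.e. the number of equivalence classes of sequences in $\{1,-1\}^n$ with exactly $k$ entries equal to $1$ under cyclic shifts and reversal only (not inversion); $B(n,k)=0$ if $k>n$. $L(n,k)$ is the number of aperiodic binary necklaces (Lyndon words) of length $n$ with $k$ ones, $L(n,k)=\frac1n\sum_{j\mid\gcd(n,k)}\mu(j)\binom{n/j}{k/j}$, with $\mu$ the Möbius function. *)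

theory Defs
  imports Complex_Main
begin

definition sign_seqs :: "nat \<Rightarrow> int list set" where
  "sign_seqs n = {s. length s = n \<and> set s \<subseteq> {1, -1}}"

inductive extension :: "int list \<Rightarrow> int list \<Rightarrow> bool" where
  "extension (xs @ [a] @ ys) (xs @ [-a, -a] @ ys)"

definition obtainable :: "int list \<Rightarrow> bool" where
  "obtainable s \<longleftrightarrow> extension\<^sup>*\<^sup>* [1, 1, 1] s"

inductive dihedral_move :: "int list \<Rightarrow> int list \<Rightarrow> bool" where
  shift: "dihedral_move s (rotate i s)"
| reversal: "dihedral_move s (rev s)"

inductive flexagon_move :: "int list \<Rightarrow> int list \<Rightarrow> bool" where
  dihedral: "dihedral_move s t \<Longrightarrow> flexagon_move s t"
| inversion: "flexagon_move s (map uminus s)"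

definition necklace_rel :: "(int list \<times> int list) set" where
  "necklace_rel = {(s, t). \<exists>i. t = rotate i s}"

definition bracelet_rel :: "(int list \<times> int list) set" where
  "bracelet_rel = {(s, t). dihedral_move\<^sup>*\<^sup>* s t}"

definition flexagon_rel :: "(int list \<times> int list) set" where
  "flexagon_rel = {(s, t). flexagon_move\<^sup>*\<^sup>* s t}"

definition H :: "nat \<Rightarrow> nat" where
  "H n = card {C \<in> sign_seqs n // flexagon_rel. \<exists>s\<in>C. obtainable s}"

definition B :: "nat \<Rightarrow> nat \<Rightarrow> nat" where
  "B n k = card ({s \<in> sign_seqs n. count_list s 1 = k} // bracelet_rel)"

definition aperiodic :: "int list \<Rightarrow> bool" where
  "aperiodic s \<longleftrightarrow> (\<forall>i. 0 < i \<and> i < length s \<longrightarrow> rotate i s \<noteq> s)"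

definition L :: "nat \<Rightarrow> nat \<Rightarrow> nat" where
  "L n k = card ({s \<in> sign_seqs n. count_list s 1 = k \<and> aperiodic s} // necklace_rel)"

definition F :: "nat \<Rightarrow> nat" where
  "F n = (\<Sum>k = 1..n div 2. \<Sum>l | l dvd gcd (n div 2) k.
            L (n div (2 * l)) (k div l) * nat \<lceil>real k / (2 * real l)\<rceil>)"

text \<open>
  The three relations are equivalence relations, so the quotients above do count
  equivalence classes; moreover the classes do not leave the sets being partitioned.
\<close>

lemma rotate_back: "\<exists>j. rotate j (rotate i s) = s"
proof (cases "s = []")
  case False
  have "rotate (length s - i mod length s) (rotate i s) = s"
  proof -
    have "rotate (length s - i mod length s) (rotate (i mod length s) s)
        = rotate (length s) s"
      using False by (simp add: rotate_rotate less_imp_le)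
    then show ?thesis by (simp add: rotate_conv_mod[of i s, symmetric])
  qed
  then show ?thesis by blast
qed simp

lemma equiv_necklace_rel: "equiv UNIV necklace_rel"
proof (rule equivI)
  show "refl necklace_rel"
    by (auto simp: refl_on_def necklace_rel_def intro: exI[of _ 0])
  show "sym necklace_rel"
    by (auto simp: sym_def necklace_rel_def) (metis rotate_back)
  show "trans necklace_rel"
    by (auto simp: trans_def necklace_rel_def rotate_rotate)
qed simp

lemma symp_dihedral_move_closure: "symp dihedral_move\<^sup>*\<^sup>*"
proof -
  have "dihedral_move t s" if "dihedral_move s t" for s t
    using that
  proof cases
    case (shift i)
    then show ?thesis by (metis rotate_back dihedral_move.shift)
  next
    case reversal
    then show ?thesis using dihedral_move.reversal[of t] by simp
  qed
  then show ?thesis by (intro symp_rtranclp sympI)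
qed

lemma symp_flexagon_move_closure: "symp flexagon_move\<^sup>*\<^sup>*"
proof -
  have reverse_step: "flexagon_move\<^sup>*\<^sup>* t s" if "flexagon_move s t" for s t
    using that
  proof cases
    case dihedral
    then have "dihedral_move\<^sup>*\<^sup>* t s"
      by (meson symp_dihedral_move_closure sympD r_into_rtranclp)
    moreover have "dihedral_move \<le> flexagon_move"
      by (intro predicate2I flexagon_move.dihedral)
    ultimately show ?thesis
      using rtranclp_mono by blast
  next
    case inversion
    then show ?thesis
      using flexagon_move.inversion[of t] by (simp add: comp_def r_into_rtranclp)
  qed
  have "flexagon_move\<^sup>*\<^sup>* t s" if "flexagon_move\<^sup>*\<^sup>* s t" for s t
    using that by induction (auto intro: rtranclp_trans reverse_step)
  then show ?thesis by (rule sympI)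
qed

lemma equiv_bracelet_rel: "equiv UNIV bracelet_rel"
  using symp_dihedral_move_closure
  by (intro equivI) (auto simp: refl_on_def sym_def symp_def trans_def bracelet_rel_def)

lemma equiv_flexagon_rel: "equiv UNIV flexagon_rel"
  using symp_flexagon_move_closure
  by (intro equivI) (auto simp: refl_on_def sym_def symp_def trans_def flexagon_rel_def)

lemma dihedral_move_invariant:
  assumes "dihedral_move s t"
  shows "(t \<in> sign_seqs n \<longleftrightarrow> s \<in> sign_seqs n) \<and> count_list t x = count_list s x"
  using assms
proof cases
  case (shift i)
  have "count_list (rotate i s) x = count_list s x"
    by (metis append_take_drop_id count_list_append add.commute rotate_drop_take)
  with shift show ?thesis by (simp add: sign_seqs_def)
qed (auto simp: sign_seqs_def)

lemma bracelet_rel_invariant: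
  assumes "(s, t) \<in> bracelet_rel"
  shows "(t \<in> sign_seqs n \<longleftrightarrow> s \<in> sign_seqs n) \<and> count_list t x = count_list s x"
proof -
  have "dihedral_move\<^sup>*\<^sup>* s t" using assms by (simp add: bracelet_rel_def)
  then show ?thesis by induction (use dihedral_move_invariant in auto)
qed

lemma flexagon_rel_invariant:
  assumes "(s, t) \<in> flexagon_rel" "s \<in> sign_seqs n"
  shows "t \<in> sign_seqs n"
proof -
  have "flexagon_move\<^sup>*\<^sup>* s t" using assms by (simp add: flexagon_rel_def)
  then show ?thesis
  proof induction
    case base
    show ?case by (rule assms)
  next
    case (step t u)
    from step.hyps(2) show ?case
    proof cases
      case dihedral
      then show ?thesis using dihedral_move_invariant step.IH by blast
    next
      case inversion
      then show ?thesis using step.IH by (auto simp: sign_seqs_def)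
    qed
  qed
qed

end

theory Submission
  imports Defs
begin

text \<open>
  A class contains an obtainable sequence iff its sum is divisible by 3 and it is not alternating:
  an extension \<open>a \<mapsto> -a, -a\<close> changes the sum by \<open>-3a\<close> and creates two equal neighbours, and
  conversely every non-alternating sequence of length at least 4 can be shortened, after a rotation,
  to a non-alternating one. Counting classes by giving each sequence the reciprocal of the size of
  its class, two numbers of ones \<open>k\<close> and \<open>n - k\<close> together contribute \<open>B n k\<close>, and the balanced
  sequences contribute half of \<open>B n (n/2)\<close> plus half the number of self-complementary bracelets.

  For \<open>n = 2m\<close> that last number is \<open>F n\<close>. Complements obtained by a reflection contribute
  \<open>2^m / 4\<close>. A necklace that is carried to its complement by a rotation is determined by its sign
  changes, which form a word of period dividing \<open>m\<close> with an odd number of changes per period.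
  In the sum defining \<open>F\<close>, \<open>\<lceil>k/2\<rceil>\<close> is \<open>k/2\<close> plus \<open>1/2\<close> for odd \<open>k\<close>, and these two parts
  give exactly the two contributions.
\<close>

section \<open>Counting classes by reciprocal weights, and elementary operations on sign
  sequences\<close>

text \<open>Over each class the reciprocals of its size add up to 1, because the closure assumption
  keeps every class inside \<open>X\<close>. This turns a count of classes into a sum over
  sequences, which can be split and reindexed freely.\<close>

lemma card_quotient_eq_sum:
  assumes "finite X" "equiv UNIV r" "\<And>x. x \<in> X \<Longrightarrow> r `` {x} \<subseteq> X"
  shows "real (card (X // r)) = (\<Sum>x\<in>X. 1 / real (card (r `` {x})))"
proof -
  have fin: "finite (X // r)"
    using assms(1) by (simp add: quotient_def)
  have "(\<Sum>x | x \<in> X \<and> r `` {x} = C. 1 / real (card (r `` {x}))) = 1" if C: "C \<in> X // r" for C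
  proof -
    from C obtain y where y: "y \<in> X" "C = r `` {y}" by (auto elim: quotientE)
    have "{x. x \<in> X \<and> r `` {x} = C} = C"
      using y assms(3)[OF y(1)] equivE[OF assms(2)]
      by (auto simp: eq_equiv_class_iff[OF assms(2)] elim: symE)
    moreover have "finite C" "C \<noteq> {}"
      using y assms(3)[OF y(1)] assms(1) finite_subset equiv_class_self[OF assms(2), of y] by auto
    moreover have "(\<Sum>x | x \<in> X \<and> r `` {x} = C. 1 / real (card (r `` {x})))
        = (\<Sum>x | x \<in> X \<and> r `` {x} = C. 1 / real (card C))"
      by (intro sum.cong) auto
    ultimately show ?thesis by simp
  qed
  then have "(\<Sum>C\<in>X // r. \<Sum>x | x \<in> X \<and> r `` {x} = C. 1 / real (card (r `` {x})))
      = (\<Sum>C\<in>X // r. 1)"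
    by (rule sum.cong[OF refl])
  then have "real (card (X // r)) = (\<Sum>C\<in>X // r. \<Sum>x | x \<in> X \<and> r `` {x} = C. 1 / real (card (r `` {x})))"
    by simp
  also have "\<dots> = (\<Sum>x\<in>X. 1 / real (card (r `` {x})))"
    using assms(1) fin by (intro sum.group) (auto intro: quotientI)
  finally show ?thesis .
qed

abbreviation neg :: "int list \<Rightarrow> int list" where
  "neg \<equiv> map uminus"

lemma neg_neg [simp]: "neg (neg x) = x"
  by (simp add: comp_def)

lemma neg_eq_iff: "neg x = y \<longleftrightarrow> x = neg y"
  by auto

lemma rotate_neg: "rotate r (neg x) = neg (rotate r x)"
  by (simp add: rotate_map)

lemma rotate_eq_iff: "rotate r x = rotate r y \<longleftrightarrow> x = y"
proof
  assume eq: "rotate r x = rotate r y"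
  then have len: "length x = length y" by (metis length_rotate)
  show "x = y"
  proof (cases "x = []")
    case False
    let ?s = "length x - r mod length x"
    have "rotate ?s (rotate (r mod length x) z) = z" if "length z = length x" for z :: "'a list"
      using that False by (simp add: rotate_rotate less_imp_le)
    then have "rotate ?s (rotate r z) = z" if "length z = length x" for z :: "'a list"
      using that rotate_conv_mod by metis
    then show ?thesis using eq len by metis
  qed (use len in auto)
qed simp

lemma finite_sign_seqs: "finite (sign_seqs n)"
  and card_sign_seqs: "card (sign_seqs n) = 2 ^ n"
proof -
  have eq: "sign_seqs n = {xs. set xs \<subseteq> {1, -1} \<and> length xs = n}"
    by (auto simp: sign_seqs_def)
  show "finite (sign_seqs n)" unfolding eq by (rule finite_lists_length_eq) simp
  show "card (sign_seqs n) = 2 ^ n" unfolding eq by (subst card_lists_length_eq) (simp_all add: numeral_2_eq_2)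
qed

lemma sign_seqs_closed:
  "rotate r x \<in> sign_seqs n \<longleftrightarrow> x \<in> sign_seqs n"
  "rev x \<in> sign_seqs n \<longleftrightarrow> x \<in> sign_seqs n"
  "neg x \<in> sign_seqs n \<longleftrightarrow> x \<in> sign_seqs n"
  by (auto simp: sign_seqs_def)

subsection \<open>Necklaces, bracelets and flexagon classes\<close>

definition necklace :: "int list \<Rightarrow> int list set" where
  "necklace x = {rotate i x | i. True}"

text \<open>Reversal conjugates rotations into rotations, so one reversal suffices: an orbit of the
  dihedral group consists of at most two necklaces.\<close>

definition bracelet :: "int list \<Rightarrow> int list set" where
  "bracelet x = necklace x \<union> necklace (rev x)"

lemma necklace_rel_image: "necklace_rel `` {x} = necklace x"
  by (auto simp: necklace_rel_def necklace_def)

lemma necklace_self: "x \<in> necklace x"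
  by (auto simp: necklace_def intro: exI[of _ 0])

lemma necklace_eq: "y \<in> necklace x \<Longrightarrow> necklace y = necklace x"
  using equiv_class_eq[OF equiv_necklace_rel, of x y] by (auto simp: necklace_rel_image[symmetric])

lemma neg_necklace: "neg ` necklace x = necklace (neg x)"
  by (auto simp: necklace_def rotate_neg image_def)

lemma rev_necklace: "rev ` necklace x = necklace (rev x)"
proof -
  have sub: "rev ` necklace y \<subseteq> necklace (rev y)" for y
  proof -
    have "\<exists>j. rev (rotate i y) = rotate j (rev y)" for i
    proof -
      obtain j where j: "rotate j (rotate i (rev (rev y))) = y" using rotate_back by force
      have "rotate i y = rev (rotate (length y - i mod length y) (rev y))"
        using rotate_rev[of i "rev y"] by simp
      then show ?thesis by (metis rev_rev_ident)
    qed
    then show ?thesis by (auto simp: necklace_def)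
  qed
  \<comment> \<open>The other inclusion is the same one for \<open>rev x\<close>, reversed once
    more.\<close>
  from sub[of "rev x"] have "rev ` rev ` necklace (rev x) \<subseteq> rev ` necklace x"
    by (intro image_mono) simp
  then have "necklace (rev x) \<subseteq> rev ` necklace x" by (simp add: image_image)
  with sub[of x] show ?thesis by blast
qed

lemma bracelet_rel_image: "bracelet_rel `` {x} = bracelet x"
proof
  have "y \<in> bracelet x" if "dihedral_move\<^sup>*\<^sup>* x y" for y
    using that
  proof induction
    case base
    show ?case by (simp add: bracelet_def necklace_self)
  next
    case (step y z)
    from step.hyps(2) show ?case
    proof cases
      case (shift i)
      then have "z \<in> necklace y" by (auto simp: necklace_def)
      then have "z \<in> necklace x \<or> z \<in> necklace (rev x)"
        using step.IH necklace_eq[of y x] necklace_eq[of y "rev x"] by (auto simp: bracelet_def)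
      then show ?thesis by (simp add: bracelet_def)
    next
      case reversal
      then show ?thesis
        using step.IH rev_necklace[of x] rev_necklace[of "rev x"] by (auto simp: bracelet_def)
    qed
  qed
  then show "bracelet_rel `` {x} \<subseteq> bracelet x" by (auto simp: bracelet_rel_def)
  have "dihedral_move\<^sup>*\<^sup>* x (rotate i x)" "dihedral_move\<^sup>*\<^sup>* x (rotate i (rev x))" for i
    by (blast intro: dihedral_move.intros converse_rtranclp_into_rtranclp r_into_rtranclp)+
  then show "bracelet x \<subseteq> bracelet_rel `` {x}"
    by (auto simp: bracelet_def necklace_def bracelet_rel_def)
qed

lemma neg_bracelet: "neg ` bracelet x = bracelet (neg x)"
  by (simp add: bracelet_def image_Un neg_necklace rev_map)

lemma bracelet_self: "x \<in> bracelet x"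
  by (simp add: bracelet_def necklace_self)

lemma bracelet_eq: "y \<in> bracelet x \<Longrightarrow> bracelet y = bracelet x"
  using equiv_class_eq[OF equiv_bracelet_rel, of x y] by (auto simp: bracelet_rel_image[symmetric])

text \<open>Inversion commutes with rotation and reversal and is an involution, so at most one
  inversion is ever needed.\<close>

lemma flexagon_rel_image: "flexagon_rel `` {x} = bracelet x \<union> bracelet (neg x)"
proof
  have "y \<in> bracelet x \<union> bracelet (neg x)" if "flexagon_move\<^sup>*\<^sup>* x y" for y
    using that
  proof induction
    case base
    show ?case by (simp add: bracelet_self)
  next
    case (step y z)
    from step.hyps(2) show ?case
    proof cases
      case dihedral
      then have "z \<in> bracelet y"
        by (auto simp: bracelet_rel_image[symmetric] bracelet_rel_def)
      then show ?thesis
        using step.IH bracelet_eq[of y x] bracelet_eq[of y "neg x"] by auto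
    next
      case inversion
      then show ?thesis
        using step.IH neg_bracelet[of x] neg_bracelet[of "neg x"] by auto
    qed
  qed
  then show "flexagon_rel `` {x} \<subseteq> bracelet x \<union> bracelet (neg x)" by (auto simp: flexagon_rel_def)
  have *: "flexagon_move\<^sup>*\<^sup>* y z" if "z \<in> bracelet y" for y z
  proof -
    have "dihedral_move\<^sup>*\<^sup>* y z"
      using that by (auto simp: bracelet_rel_image[symmetric] bracelet_rel_def)
    moreover have "dihedral_move \<le> flexagon_move"
      by (intro predicate2I flexagon_move.dihedral)
    ultimately show ?thesis using rtranclp_mono by blast
  qed
  have "flexagon_move\<^sup>*\<^sup>* x z" if "z \<in> bracelet (neg x)" for z
    using *[OF that] flexagon_move.inversion converse_rtranclp_into_rtranclp by metis
  with * show "bracelet x \<union> bracelet (neg x) \<subseteq> flexagon_rel `` {x}"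
    by (auto simp: flexagon_rel_def)
qed

lemma necklace_subset: "x \<in> sign_seqs n \<Longrightarrow> necklace x \<subseteq> sign_seqs n"
  by (auto simp: necklace_def sign_seqs_closed)

lemma bracelet_subset: "x \<in> sign_seqs n \<Longrightarrow> bracelet x \<subseteq> sign_seqs n"
  using necklace_subset sign_seqs_closed(2) unfolding bracelet_def by blast

lemma finite_necklace: "x \<in> sign_seqs n \<Longrightarrow> finite (necklace x)"
  using necklace_subset finite_sign_seqs finite_subset by blast

lemma finite_bracelet: "x \<in> sign_seqs n \<Longrightarrow> finite (bracelet x)"
  using bracelet_subset finite_sign_seqs finite_subset by blast

lemma card_necklace_rev: "card (necklace (rev x)) = card (necklace x)"
  by (simp add: rev_necklace[symmetric] card_image)

lemma card_bracelet_neg: "card (bracelet (neg x)) = card (bracelet x)"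
proof -
  have "inj neg" by (rule injI) (metis neg_neg)
  then show ?thesis by (metis neg_bracelet card_image inj_on_subset subset_UNIV)
qed

text \<open>A class that is the union of two classes of equal size of a finer relation is either one
  of them or twice as large.\<close>

lemma inverse_card_flexagon_class:
  assumes "x \<in> sign_seqs n"
  shows "1 / real (card (flexagon_rel `` {x}))
    = 1 / 2 * (1 / real (card (bracelet x)))
      + 1 / 2 * (if neg x \<in> bracelet x then 1 / real (card (bracelet x)) else 0)"
proof (cases "neg x \<in> bracelet x")
  case True
  then show ?thesis by (simp add: flexagon_rel_image bracelet_eq)
next
  case False
  then have "bracelet x \<inter> bracelet (neg x) = {}"
    by (metis bracelet_eq bracelet_self disjoint_iff)
  moreover have "finite (bracelet x)" "finite (bracelet (neg x))"
    using assms finite_bracelet sign_seqs_closed(3) by blast+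
  ultimately show ?thesis
    using False by (simp add: flexagon_rel_image card_Un_disjoint card_bracelet_neg)
qed

text \<open>Applied later with \<open>y = neg x\<close>, where the two summands separate the
  complements reached by a rotation from those reached by a reflection.\<close>

lemma inverse_card_bracelet:
  assumes "x \<in> sign_seqs n"
  shows "(if y \<in> bracelet x then 1 / real (card (bracelet x)) else 0)
    = 1 / 2 * (if y \<in> necklace x then 1 / real (card (necklace x)) else 0)
      + 1 / 2 * (if y \<in> necklace (rev x) then 1 / real (card (necklace x)) else 0)"
proof (cases "rev x \<in> necklace x")
  case True
  then show ?thesis by (simp add: bracelet_def necklace_eq)
next
  case False
  then have disj: "necklace x \<inter> necklace (rev x) = {}"
    by (metis necklace_eq necklace_self disjoint_iff)
  moreover have "finite (necklace x)" "finite (necklace (rev x))"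
    using assms finite_necklace sign_seqs_closed(2) by blast+
  ultimately have "card (bracelet x) = 2 * card (necklace x)"
    by (simp add: bracelet_def card_Un_disjoint card_necklace_rev)
  then show ?thesis using disj by (auto simp: bracelet_def)
qed

subsection \<open>Obtainable classes\<close>

lemma sum_list_neg: "sum_list (neg x) = - sum_list x"
  by (induction x) auto

lemma sum_list_rotate: "sum_list (rotate i x) = sum_list (x :: int list)"
  by (metis append_take_drop_id sum_list_append add.commute rotate_drop_take)

lemma flexagon_move_dvd_sum_list: "flexagon_move s t \<Longrightarrow> d dvd sum_list s \<longleftrightarrow> d dvd sum_list t"
  by (auto elim!: flexagon_move.cases dihedral_move.cases simp: sum_list_rotate sum_list_neg sum_list_rev)

text \<open>The equation \<open>rotate1 s = neg s\<close> expresses that cyclic neighbours are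
  opposite. It is compatible with rotation and inversion; reversal replaces the rotation by its
  inverse, which gives the same condition since negation is an involution.\<close>

lemma flexagon_move_alternating:
  assumes "flexagon_move s t" "rotate1 s = neg s"
  shows "rotate1 t = neg t"
  using assms(1)
proof cases
  case dihedral
  then show ?thesis
  proof cases
    case (shift i)
    then show ?thesis using assms(2) by (metis rotate1_rotate_swap rotate_neg)
  next
    case reversal
    have "rotate1 (neg (rev s)) = rev s"
    proof (cases s)
      case (Cons a u)
      then have "u @ [a] = - a # neg u" using assms(2) by simp
      then have "a # rev u = neg (rev s)" using Cons by (metis rev.simps(2) rev_append rev_map rev_rev_ident append_Cons append_Nil map_append list.map)
      then have "rotate1 (neg (rev s)) = rev u @ [a]" by (metis rotate1.simps(2))
      then show ?thesis using Cons by simp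
    qed simp
    then show ?thesis using reversal by (metis neg_neg rotate1_map)
  qed
next
  case inversion
  then show ?thesis using assms(2) by (metis rotate1_map)
qed

lemma flexagon_rel_cong:
  assumes "(s, t) \<in> flexagon_rel"
  shows "(d dvd sum_list s \<longleftrightarrow> d dvd sum_list t) \<and> (rotate1 s = neg s \<longleftrightarrow> rotate1 t = neg t)"
proof -
  have "(d dvd sum_list s \<longleftrightarrow> d dvd sum_list t) \<and> (rotate1 s = neg s \<longrightarrow> rotate1 t = neg t)"
    if "flexagon_move\<^sup>*\<^sup>* s t" for s t
    using that by induction (use flexagon_move_dvd_sum_list flexagon_move_alternating in blast)+
  moreover have "flexagon_move\<^sup>*\<^sup>* s t" "flexagon_move\<^sup>*\<^sup>* t s"
    using assms symp_flexagon_move_closure by (auto simp: flexagon_rel_def dest: sympD)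
  ultimately show ?thesis by blast
qed

lemma not_alternating_if_pair:
  assumes "a \<noteq> 0"
  shows "rotate1 (xs @ [a, a] @ ys) \<noteq> neg (xs @ [a, a] @ ys)"
proof
  assume "rotate1 (xs @ [a, a] @ ys) = neg (xs @ [a, a] @ ys)"
  \<comment> \<open>With the pair rotated to the front, the first entries of the two sides are
    \<open>a\<close> and \<open>- a\<close>.\<close>
  then have "rotate1 (rotate (length xs) (xs @ [a, a] @ ys)) = neg (rotate (length xs) (xs @ [a, a] @ ys))"
    by (metis rotate1_rotate_swap rotate_neg)
  then show False using assms by (simp add: rotate_append)
qed

text \<open>The conjunct \<open>0 \<notin> set s\<close> is carried through the induction because a
  pair of equal neighbours excludes alternation only when it is nonzero.\<close>

lemma obtainable_necessary:
  assumes "obtainable s"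
  shows "3 dvd sum_list s \<and> rotate1 s \<noteq> neg s \<and> 0 \<notin> set s"
  using assms unfolding obtainable_def
proof induction
  case base
  show ?case by simp
next
  case (step s t)
  from step.hyps(2) step.IH show ?case
  proof cases
    case (1 xs a ys)
    have "sum_list t = sum_list s - 3 * a" using 1 by simp
    then have "3 dvd sum_list t" using step.IH by simp
    then show ?thesis using 1 step.IH not_alternating_if_pair[of "- a" xs ys] by auto
  qed
qed

text \<open>The same entry is extended in its new position. Extensions can thus be transported along
  moves, so that sequences need to be shortened only up to equivalence.\<close>

lemma extension_move:
  assumes "extension s t" "flexagon_move s s'"
  shows "\<exists>t'. extension s' t' \<and> flexagon_move\<^sup>*\<^sup>* t t'"
  using assms(1)
proof cases
  case (1 xs a ys)
  have rot1: "\<exists>t'. extension (rotate1 s) t' \<and> (\<exists>j. t' = rotate j t)" if ext: "extension s t" for s t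
    using ext
  proof cases
    case (1 xs a ys)
    show ?thesis
    proof (cases xs)
      case Nil
      \<comment> \<open>The extended entry is the first one and wraps around to the end; its two
        replacements must both follow, which takes a rotation by 2.\<close>
      have "extension (ys @ [a] @ []) (ys @ [- a, - a] @ [])" by (rule extension.intros)
      moreover have "ys @ [- a, - a] = rotate 2 t"
        using 1 Nil by (simp add: numeral_2_eq_2)
      ultimately show ?thesis using 1 Nil by auto
    next
      case (Cons c zs)
      have "extension (zs @ [a] @ (ys @ [c])) (zs @ [- a, - a] @ (ys @ [c]))"
        by (rule extension.intros)
      then have "extension (rotate1 s) (rotate 1 t)" using 1 Cons by simp
      then show ?thesis by blast
    qed
  qed
  have rot: "\<exists>t'. extension (rotate i s) t' \<and> (\<exists>j. t' = rotate j t)" for i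
  proof (induction i)
    case 0
    have "t = rotate 0 t" by simp
    then show ?case using assms(1) by (metis rotate0 id_apply)
  next
    case (Suc i)
    then show ?case using rot1 by (metis rotate_Suc rotate_rotate)
  qed
  from assms(2) show ?thesis
  proof cases
    case dihedral
    then show ?thesis
    proof cases
      case (shift i)
      then show ?thesis using rot[of i] by (metis dihedral_move.shift flexagon_move.dihedral r_into_rtranclp)
    next
      case reversal
      have "extension (rev ys @ [a] @ rev xs) (rev ys @ [- a, - a] @ rev xs)" by (rule extension.intros)
      then have "extension s' (rev t)" using 1 reversal by simp
      then show ?thesis by (metis dihedral_move.reversal flexagon_move.dihedral r_into_rtranclp)
    qed
  next
    case inversion
    have "extension (neg xs @ [- a] @ neg ys) (neg xs @ [- (- a), - (- a)] @ neg ys)"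
      by (rule extension.intros)
    then have "extension s' (neg t)" using 1 inversion by simp
    then show ?thesis by (metis flexagon_move.inversion r_into_rtranclp)
  qed
qed

lemma extension_moves:
  assumes "flexagon_move\<^sup>*\<^sup>* s s'" "extension s t"
  shows "\<exists>t'. extension s' t' \<and> flexagon_move\<^sup>*\<^sup>* t t'"
  using assms
proof induction
  case (step u v)
  then show ?case by (metis extension_move rtranclp_trans)
qed blast



section \<open>Cyclic indexing, and shortening by merging equal neighbours\<close>

text \<open>The list is read as a periodic function on the naturals, so that rotation becomes a
  shift of the argument.\<close>

definition cyc :: "int list \<Rightarrow> nat \<Rightarrow> int" where
  "cyc x i = x ! (i mod length x)"

lemma cyc_rotate: "x \<noteq> [] \<Longrightarrow> cyc (rotate r x) i = cyc x (i + r)"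
  by (simp add: cyc_def nth_rotate mod_add_right_eq add.commute)

lemma cyc_neg: "x \<noteq> [] \<Longrightarrow> cyc (neg x) i = - cyc x i"
  by (simp add: cyc_def)

lemma cyc_inject:
  assumes "length x = length y" "\<And>i. cyc x i = cyc y i"
  shows "x = y"
proof (rule nth_equalityI)
  fix i assume "i < length x"
  then show "x ! i = y ! i" using assms(1) assms(2)[of i] by (simp add: cyc_def)
qed fact

lemma cyc_period: "cyc x (i + length x) = cyc x i"
  by (simp add: cyc_def)

lemma cyc_sign: "x \<in> sign_seqs n \<Longrightarrow> 0 < n \<Longrightarrow> cyc x i = 1 \<or> cyc x i = - 1"
  using nth_mem[of "i mod n" x] unfolding cyc_def sign_seqs_def by fastforce

lemma rotate1_not_neg_if_pair: "a \<noteq> 0 \<Longrightarrow> rotate1 (a # a # zs) \<noteq> neg (a # a # zs)"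
  using not_alternating_if_pair[of a "[]" zs] by simp

text \<open>Merging the first two entries of \<open>a, a, -a, \<dots>\<close> again leaves two equal neighbours, so
  the merging can be repeated.\<close>

lemma mergeable_pair:
  assumes "x \<in> sign_seqs n" "n \<ge> 4" "rotate1 x \<noteq> neg x"
  shows "\<exists>a zs. (\<exists>r. rotate r x = a # a # zs) \<and> rotate1 (- a # zs) \<noteq> neg (- a # zs)"
proof -
  have len: "length x = n" and ne: "x \<noteq> []" using assms by (auto simp: sign_seqs_def)
  have sign: "cyc x i = 1 \<or> cyc x i = - 1" for i using cyc_sign assms by simp
  obtain i0 where i0: "cyc x (Suc i0) = cyc x i0"
  proof -
    have "\<exists>i. cyc (rotate 1 x) i \<noteq> cyc (neg x) i"
      using cyc_inject[of "rotate 1 x" "neg x"] assms(3) by auto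
    then obtain i where "cyc x (i + 1) \<noteq> - cyc x i"
      unfolding cyc_rotate[OF ne] cyc_neg[OF ne] by blast
    then have "cyc x (Suc i) = cyc x i" using sign[of i] sign[of "i + 1"] by auto
    then show thesis by (rule that)
  qed
  have split: "rotate i x = cyc x i # cyc x (Suc i) # cyc x (Suc (Suc i)) # drop 3 (rotate i x)" for i
  proof -
    have "\<exists>a b c zs. xs = a # b # c # zs" if "3 \<le> length xs" for xs :: "int list"
      using that by (auto simp: numeral_3_eq_3 Suc_le_length_iff)
    moreover have "3 \<le> length (rotate i x)" using assms(2) len by simp
    ultimately obtain a b c zs where abc: "rotate i x = a # b # c # zs" by blast
    have "cyc (rotate i x) 0 = a" "cyc (rotate i x) 1 = b" "cyc (rotate i x) 2 = c"
      unfolding abc by (simp_all add: cyc_def)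
    then have "cyc x i = a" "cyc x (Suc i) = b" "cyc x (Suc (Suc i)) = c"
      by (simp_all add: cyc_rotate[OF ne])
    then show ?thesis unfolding abc by (simp add: numeral_3_eq_3)
  qed
  show ?thesis
  \<comment> \<open>Either some run of at least two equal entries ends, and its last two entries are
    merged, or the pair at \<open>i0\<close> propagates and the whole sequence is constant.\<close>
  proof (cases "\<exists>i. cyc x (Suc i) = cyc x i \<and> cyc x (Suc (Suc i)) \<noteq> cyc x i")
    case True
    then obtain i where i: "cyc x (Suc i) = cyc x i" "cyc x (Suc (Suc i)) = - cyc x i"
      using sign by (metis minus_minus)
    define a where "a = cyc x i"
    have "a \<noteq> 0" using sign[of i] a_def by auto
    then have "rotate1 (- a # - a # drop 3 (rotate i x)) \<noteq> neg (- a # - a # drop 3 (rotate i x))"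
      by (intro rotate1_not_neg_if_pair) simp
    moreover have "rotate i x = a # a # - a # drop 3 (rotate i x)"
      by (subst split) (simp add: i a_def)
    ultimately show ?thesis by blast
  next
    case False
    have const: "cyc x (i0 + j) = cyc x i0 \<and> cyc x (Suc (i0 + j)) = cyc x i0" for j
    proof (induction j)
      case 0
      show ?case using i0 by simp
    next
      case (Suc j)
      then have "cyc x (Suc (Suc (i0 + j))) = cyc x (i0 + j)" using False by auto
      then show ?case using Suc by simp
    qed
    define a where "a = cyc x i0"
    have a: "a \<noteq> 0" using sign[of i0] a_def by auto
    have all: "y = a" if "y \<in> set (rotate i0 x)" for y
    proof -
      from that obtain j where "j < n" "y = rotate i0 x ! j"
        unfolding in_set_conv_nth length_rotate len by blast
      then have "y = cyc (rotate i0 x) j" using len by (simp add: cyc_def)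
      then show ?thesis using const[of j] ne by (simp add: cyc_rotate a_def add.commute)
    qed
    then have rep: "rotate i0 x = replicate n a"
      using len by (intro replicate_eqI) auto
    \<comment> \<open>Length at least 4 ensures that two equal neighbours remain after the first two
      entries of the constant sequence are merged.\<close>
    obtain m where m: "n = Suc (Suc (Suc (Suc m)))"
    proof (rule that)
      show "n = Suc (Suc (Suc (Suc (n - 4))))" using assms(2) by arith
    qed
    have "rotate i0 x = a # a # a # a # replicate m a" using rep m by simp
    moreover have "rotate1 (- a # a # a # replicate m a) \<noteq> neg (- a # a # a # replicate m a)"
      using a by simp
    ultimately show ?thesis by blast
  qed
qed

text \<open>Induction on the length. Merging a pair \<open>a, a\<close> into \<open>- a\<close>
  changes the sum by \<open>- 3 * a\<close>, and \<open>mergeable_pair\<close> keeps the result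
  non-alternating. The extension that undoes the merge is carried over to the obtainable
  representative by \<open>extension_moves\<close>. At length 3, divisibility of the sum forces a
  constant sequence.\<close>

lemma obtainable_sufficient:
  assumes "x \<in> sign_seqs n" "n \<ge> 3" "3 dvd sum_list x" "rotate1 x \<noteq> neg x"
  shows "\<exists>s. obtainable s \<and> flexagon_move\<^sup>*\<^sup>* x s"
  using assms(2,1,3,4)
proof (induction n arbitrary: x rule: nat_induct_at_least)
  case base
  then obtain a b c where abc: "x = [a, b, c]"
    by (auto simp: sign_seqs_def numeral_3_eq_3 length_Suc_conv)
  then have "x = [1, 1, 1] \<or> x = neg [1, 1, 1]"
    using base by (auto simp: sign_seqs_def)
  moreover have "flexagon_move\<^sup>*\<^sup>* (neg [1, 1, 1]) [1, 1, 1]"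
    using flexagon_move.inversion[of "neg [1, 1, 1]"] by auto
  ultimately show ?case by (auto simp: obtainable_def)
next
  case (Suc n)
  from mergeable_pair[of x "Suc n"] Suc.prems Suc.hyps obtain a zs r
    where r: "rotate r x = a # a # zs" and nonalt: "rotate1 (- a # zs) \<noteq> neg (- a # zs)"
    by auto
  have mem: "a # a # zs \<in> sign_seqs (Suc n)" using Suc.prems(1) r sign_seqs_closed(1) by metis
  have "3 dvd sum_list (a # a # zs)" using Suc.prems(2) r sum_list_rotate by metis
  then have "3 dvd sum_list (a # a # zs) - 3 * a" by (metis dvd_diff dvd_triv_left)
  then have "3 dvd sum_list (- a # zs)" by (simp add: algebra_simps)
  moreover have "- a # zs \<in> sign_seqs n" using mem by (auto simp: sign_seqs_def)
  ultimately obtain s where s: "obtainable s" "flexagon_move\<^sup>*\<^sup>* (- a # zs) s"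
    using Suc.IH nonalt by blast
  have "extension (- a # zs) (a # a # zs)"
    using extension.intros[of "[]" "- a" zs] by simp
  from extension_moves[OF s(2) this] obtain t
    where t: "extension s t" "flexagon_move\<^sup>*\<^sup>* (a # a # zs) t" by blast
  have "flexagon_move x (a # a # zs)" using r by (metis dihedral_move.shift flexagon_move.dihedral)
  then have "flexagon_move\<^sup>*\<^sup>* x t" using t(2) by (rule converse_rtranclp_into_rtranclp)
  moreover have "obtainable t" using s(1) t(1) unfolding obtainable_def by auto
  ultimately show ?case by blast
qed

lemma class_obtainable_iff:
  assumes "x \<in> sign_seqs n" "n \<ge> 3"
  shows "(\<exists>s\<in>flexagon_rel `` {x}. obtainable s) \<longleftrightarrow> 3 dvd sum_list x \<and> rotate1 x \<noteq> neg x"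
proof
  assume "\<exists>s\<in>flexagon_rel `` {x}. obtainable s"
  then show "3 dvd sum_list x \<and> rotate1 x \<noteq> neg x"
    using obtainable_necessary flexagon_rel_cong by blast
next
  assume "3 dvd sum_list x \<and> rotate1 x \<noteq> neg x"
  then show "\<exists>s\<in>flexagon_rel `` {x}. obtainable s"
    using obtainable_sufficient[OF assms] by (auto simp: flexagon_rel_def)
qed

subsection \<open>Periodic sign functions\<close>

definition least_period :: "(nat \<Rightarrow> int) \<Rightarrow> nat" where
  "least_period f = (LEAST p. 0 < p \<and> (\<forall>i. f (i + p) = f i))"

text \<open>A word and its repetitions are the same function, so words of every length dividing
  \<open>n\<close> live in one set. This lets the divisor sum in \<open>F\<close> become a single
  sum.\<close>

definition periodic_signs :: "nat \<Rightarrow> (nat \<Rightarrow> int) set" where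
  "periodic_signs n = {f. (\<forall>i. f i = 1 \<or> f i = - 1) \<and> (\<forall>i. f (i + n) = f i)}"

text \<open>Counts over one least period, hence in the primitive word and not in its
  repetitions.\<close>

definition num_ones :: "(nat \<Rightarrow> int) \<Rightarrow> nat" where
  "num_ones f = card {i. i < least_period f \<and> f i = 1}"

lemma period_mult:
  fixes f :: "nat \<Rightarrow> 'a"
  assumes "\<And>i. f (i + p) = f i"
  shows "f (i + p * q) = f i"
proof (induction q)
  case (Suc q)
  have "f (i + p * Suc q) = f (i + p * q + p)" by (simp add: algebra_simps)
  then show ?case using assms Suc by simp
qed simp

lemma least_period:
  assumes "0 < n" "\<And>i. f (i + n) = f i"
  shows "0 < least_period f" "f (i + least_period f) = f i"
    "(\<forall>i. f (i + r) = f i) \<longleftrightarrow> least_period f dvd r"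
proof -
  define p where "p = least_period f"
  have "0 < p \<and> (\<forall>i. f (i + p) = f i)"
    unfolding p_def least_period_def by (rule LeastI[of _ n]) (use assms in auto)
  then have p: "0 < p" "\<And>i. f (i + p) = f i" by auto
  then show "0 < least_period f" "f (i + least_period f) = f i" by (simp_all add: p_def)
  show "(\<forall>i. f (i + r) = f i) \<longleftrightarrow> least_period f dvd r"
    unfolding p_def[symmetric]
  proof
    assume r: "\<forall>i. f (i + r) = f i"
    have "f (i + r mod p) = f i" for i
    proof -
      have "f (i + r mod p) = f (i + r mod p + p * (r div p))"
        using period_mult[of f p "i + r mod p" "r div p"] p(2) by simp
      also have "\<dots> = f (i + r)" by (metis add.assoc mod_mult_div_eq)
      finally show ?thesis using r by simp
    qed
    then have "\<not> 0 < r mod p"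
      using Least_le[of "\<lambda>p. 0 < p \<and> (\<forall>i. f (i + p) = f i)" "r mod p"] mod_less_divisor[OF p(1), of r]
      by (auto simp: p_def least_period_def)
    then show "p dvd r" by auto
  next
    assume "p dvd r"
    then show "\<forall>i. f (i + r) = f i" using period_mult[of f p] p(2) by (auto elim!: dvdE)
  qed
qed

lemma periodic_signs_iff:
  assumes "f \<in> periodic_signs n" "0 < n" "0 < m"
  shows "f \<in> periodic_signs m \<longleftrightarrow> least_period f dvd m"
  using assms least_period(3)[of n f m] by (auto simp: periodic_signs_def)

lemma least_period_pos: "f \<in> periodic_signs n \<Longrightarrow> 0 < n \<Longrightarrow> 0 < least_period f"
  using least_period(1)[of n f] by (simp add: periodic_signs_def)

lemma least_period_shift_eq_iff:
  assumes "f \<in> periodic_signs n" "0 < n"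
  shows "(\<forall>i. f (i + r) = f (i + s)) \<longleftrightarrow> r mod least_period f = s mod least_period f"
proof -
  have wlog: "(\<forall>i. f (i + r) = f (i + s)) \<longleftrightarrow> r mod least_period f = s mod least_period f"
    if "r \<le> s" for r s
  proof -
    have per: "\<And>i. f (i + n) = f i" using assms by (simp add: periodic_signs_def)
    have "(\<forall>i. f (i + r) = f (i + s)) \<longleftrightarrow> (\<forall>i. f (i + (s - r)) = f i)"
    proof
      assume *: "\<forall>i. f (i + r) = f (i + s)"
      have "f (i + (s - r)) = f i" for i
      proof -
        \<comment> \<open>A shift by \<open>r\<close> cannot be undone on the naturals; adding the
          period \<open>n * r\<close> first makes room to subtract \<open>r\<close>.\<close>
        have "r \<le> n * r" using assms(2) by simp
        then have "i + (s - r) + n * r = i + (n * r - r) + s" using that by linarith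
        then have "f (i + (s - r)) = f (i + (n * r - r) + s)"
          using period_mult[of f n "i + (s - r)" r, OF per] by metis
        also have "\<dots> = f (i + (n * r - r) + r)" using * by simp
        also have "\<dots> = f (i + n * r)"
          using \<open>r \<le> n * r\<close> by (simp only: add.assoc le_add_diff_inverse2)
        finally show ?thesis using period_mult[of f n i r, OF per] by simp
      qed
      then show "\<forall>i. f (i + (s - r)) = f i" by blast
    next
      assume "\<forall>i. f (i + (s - r)) = f i"
      then have "f (i + r + (s - r)) = f (i + r)" for i by blast
      then show "\<forall>i. f (i + r) = f (i + s)" using that by simp
    qed
    also have "\<dots> \<longleftrightarrow> least_period f dvd s - r" by (rule least_period(3)[of n f]) (fact assms(2), fact per)
    also have "\<dots> \<longleftrightarrow> r mod least_period f = s mod least_period f"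
      using that by (metis mod_eq_dvd_iff_nat)
    finally show ?thesis .
  qed
  show ?thesis using wlog[of r s] wlog[of s r] by (metis nat_le_linear)
qed

lemma cyc_bij:
  assumes "0 < n"
  shows "bij_betw cyc (sign_seqs n) (periodic_signs n)"
proof (rule bij_betw_imageI)
  show "inj_on cyc (sign_seqs n)"
  proof (rule inj_onI)
    fix x y assume "x \<in> sign_seqs n" "y \<in> sign_seqs n" "cyc x = cyc y"
    then show "x = y" using cyc_inject[of x y] by (simp add: sign_seqs_def)
  qed
  have "cyc x \<in> periodic_signs n" if "x \<in> sign_seqs n" for x
    using that cyc_sign[OF that assms] cyc_period[of x]
    by (simp add: periodic_signs_def sign_seqs_def)
  moreover have "f \<in> cyc ` sign_seqs n" if f: "f \<in> periodic_signs n" for f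
  proof
    show "map f [0..<n] \<in> sign_seqs n" using f by (auto simp: sign_seqs_def periodic_signs_def)
    show "f = cyc (map f [0..<n])"
    proof
      fix i
      have "f (i mod n + n * (i div n)) = f (i mod n)"
        using f by (intro period_mult) (simp add: periodic_signs_def)
      then show "f i = cyc (map f [0..<n]) i" using assms by (simp add: cyc_def)
    qed
  qed
  ultimately show "cyc ` sign_seqs n = periodic_signs n" by blast
qed

lemma cyc_in: "x \<in> sign_seqs n \<Longrightarrow> 0 < n \<Longrightarrow> cyc x \<in> periodic_signs n"
  using cyc_bij bij_betwE by blast

lemma finite_periodic_signs: "0 < n \<Longrightarrow> finite (periodic_signs n)"
  and card_periodic_signs: "0 < n \<Longrightarrow> card (periodic_signs n) = 2 ^ n"
  using bij_betw_finite[OF cyc_bij] bij_betw_same_card[OF cyc_bij] finite_sign_seqs card_sign_seqs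
  by metis+

lemma rotate_eq_rotate_iff:
  assumes "x \<in> sign_seqs n" "0 < n"
  shows "rotate r x = rotate s x \<longleftrightarrow> r mod least_period (cyc x) = s mod least_period (cyc x)"
proof -
  have "x \<noteq> []" using assms by (auto simp: sign_seqs_def)
  then have "rotate r x = rotate s x \<longleftrightarrow> (\<forall>i. cyc x (i + r) = cyc x (i + s))"
    using cyc_inject[of "rotate r x" "rotate s x"] cyc_rotate by (metis length_rotate)
  then show ?thesis using least_period_shift_eq_iff[OF cyc_in[OF assms] assms(2)] by blast
qed

lemma card_necklace:
  assumes "x \<in> sign_seqs n" "0 < n"
  shows "card (necklace x) = least_period (cyc x)"
proof -
  let ?p = "least_period (cyc x)"
  have pos: "0 < ?p" using least_period_pos cyc_in assms by blast
  have "necklace x = (\<lambda>r. rotate r x) ` {..<?p}"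
  proof -
    have "rotate r x \<in> (\<lambda>r. rotate r x) ` {..<?p}" for r
    proof
      show "rotate r x = rotate (r mod ?p) x" by (simp only: rotate_eq_rotate_iff[OF assms] mod_mod_trivial)
    qed (use pos in simp)
    then show ?thesis by (auto simp: necklace_def)
  qed
  moreover have "inj_on (\<lambda>r. rotate r x) {..<?p}"
    by (rule inj_onI) (use rotate_eq_rotate_iff[OF assms] in auto)
  ultimately show ?thesis by (simp add: card_image)
qed

lemma least_period_dvd: "f \<in> periodic_signs n \<Longrightarrow> 0 < n \<Longrightarrow> least_period f dvd n"
  using periodic_signs_iff by blast

text \<open>Orbit-stabilizer in summable form: a member of the necklace is reached by exactly
  \<open>n\<close> divided by the least period of the rotations with \<open>r < n\<close>. The
  weight becomes a count of rotations, which permits exchanging sums.\<close>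

lemma card_rotations:
  assumes "x \<in> sign_seqs n" "0 < n"
  shows "(if y \<in> necklace x then 1 / real (card (necklace x)) else 0)
    = real (card {r. r < n \<and> rotate r x = y}) / real n"
proof (cases "y \<in> necklace x")
  case True
  let ?p = "least_period (cyc x)"
  have pos: "0 < ?p" using least_period_pos cyc_in assms by blast
  obtain q where q: "n = ?p * q" using least_period_dvd[OF cyc_in[OF assms] assms(2)] by (auto elim: dvdE)
  from True obtain s where s: "y = rotate s x" by (auto simp: necklace_def)
  \<comment> \<open>The suitable \<open>r\<close> form one residue class modulo the least
    period.\<close>
  have "bij_betw (\<lambda>j. s mod ?p + ?p * j) {..<q} {r. r < n \<and> rotate r x = y}"
  proof (rule bij_betw_byWitness[where f' = "\<lambda>r. r div ?p"])
    show "\<forall>j\<in>{..<q}. (s mod ?p + ?p * j) div ?p = j" using pos by simp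
    show "\<forall>r\<in>{r. r < n \<and> rotate r x = y}. s mod ?p + ?p * (r div ?p) = r"
    proof
      fix r assume "r \<in> {r. r < n \<and> rotate r x = y}"
      then have "r mod ?p = s mod ?p" using s rotate_eq_rotate_iff[OF assms] by blast
      then show "s mod ?p + ?p * (r div ?p) = r" by (metis mod_mult_div_eq)
    qed
    have "s mod ?p + ?p * j < n" if "j < q" for j
    proof -
      have "s mod ?p + ?p * j < ?p * Suc j" using pos by simp
      also have "\<dots> \<le> ?p * q" using that by (intro mult_le_mono2) simp
      finally show ?thesis using q by simp
    qed
    then show "(\<lambda>j. s mod ?p + ?p * j) ` {..<q} \<subseteq> {r. r < n \<and> rotate r x = y}"
      by (auto simp: s rotate_eq_rotate_iff[OF assms])
    have "r div ?p < q" if "r < n" for r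
      using that less_mult_imp_div_less[of r q ?p] by (simp only: q mult.commute)
    then show "(\<lambda>r. r div ?p) ` {r. r < n \<and> rotate r x = y} \<subseteq> {..<q}"
      by blast
  qed
  then have "card {r. r < n \<and> rotate r x = y} = q" using bij_betw_same_card by fastforce
  moreover have "real n = real ?p * real q" using q by (metis of_nat_mult)
  moreover have "0 < q" using q assms(2) by (metis mult_0_right neq0_conv)
  ultimately show ?thesis using True pos card_necklace[OF assms] by simp
next
  case False
  then show ?thesis by (auto simp: necklace_def)
qed


subsection \<open>Self-complementary sequences\<close>

text \<open>The first half can be chosen freely and determines the second.\<close>

lemma card_rev_eq_neg: "card {x \<in> sign_seqs (2 * m). rev x = neg x} = 2 ^ m"
proof -
  have "bij_betw (\<lambda>u. u @ neg (rev u)) (sign_seqs m) {x \<in> sign_seqs (2 * m). rev x = neg x}"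
  proof (rule bij_betw_byWitness[where f' = "take m"])
    show "\<forall>u\<in>sign_seqs m. take m (u @ neg (rev u)) = u" by (simp add: sign_seqs_def)
    show "\<forall>x\<in>{x \<in> sign_seqs (2 * m). rev x = neg x}. take m x @ neg (rev (take m x)) = x"
    proof safe
      fix x assume x: "x \<in> sign_seqs (2 * m)" "rev x = neg x"
      then have "x = neg (rev x)" by (metis neg_neg)
      then have "drop m x = drop m (neg (rev x))" by metis
      also have "\<dots> = neg (rev (take m x))"
        using x(1) by (simp add: sign_seqs_def drop_map drop_rev mult_2)
      finally show "take m x @ neg (rev (take m x)) = x" by (metis append_take_drop_id)
    qed
    have "u @ neg (rev u) \<in> sign_seqs (2 * m)" if "u \<in> sign_seqs m" for u
    proof -
      have "neg (rev u) \<in> sign_seqs m" using that by (simp only: sign_seqs_closed)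
      with that show ?thesis by (simp add: sign_seqs_def mult_2 del: set_map set_rev)
    qed
    then show "(\<lambda>u. u @ neg (rev u)) ` sign_seqs m \<subseteq> {x \<in> sign_seqs (2 * m). rev x = neg x}"
      by (auto simp: rev_map)
    show "take m ` {x \<in> sign_seqs (2 * m). rev x = neg x} \<subseteq> sign_seqs m"
      by (auto simp: sign_seqs_def dest: in_set_takeD)
  qed
  from bij_betw_same_card[OF this] show ?thesis by (simp only: card_sign_seqs)
qed

text \<open>For even \<open>r\<close> the reflection is conjugate, by a rotation, to plain reversal.
  For odd \<open>r\<close> it fixes a position, whose entry would have to be its own
  negative.\<close>

lemma card_reflection_eq_neg:
  assumes "r < 2 * m"
  shows "card {x \<in> sign_seqs (2 * m). rotate r (rev x) = neg x} = (if even r then 2 ^ m else 0)"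
proof (cases "even r")
  case True
  then obtain t where t: "r = t + t" by (metis evenE mult_2)
  let ?A = "{x \<in> sign_seqs (2 * m). rotate r (rev x) = neg x}"
  let ?B = "{y \<in> sign_seqs (2 * m). rev y = neg y}"
  have iff: "rotate r (rev x) = neg x \<longleftrightarrow> rev (rotate t (rev x)) = neg (rotate t (rev x))"
    if "length x = 2 * m" for x :: "int list"
  proof -
    let ?s = "2 * m - t"
    have full: "rotate ?s (rotate t z) = z" if "length z = 2 * m" for z :: "int list"
      using that assms t by (simp add: rotate_rotate)
    \<comment> \<open>Rotating back by half of \<open>r\<close> distributes the shift evenly over
      the two sides.\<close>
    have "rotate r (rev x) = neg x \<longleftrightarrow> rotate ?s (rotate t (rotate t (rev x))) = rotate ?s (neg x)"
      by (simp only: rotate_eq_iff) (simp add: t rotate_rotate)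
    moreover have "rotate ?s (rotate t (rotate t (rev x))) = rotate t (rev x)"
      using that by (intro full) simp
    moreover have "rotate ?s x = rev (rotate t (rev x))"
      using that assms t by (simp add: rotate_rev)
    ultimately show ?thesis using neg_eq_iff[of "rotate t (rev x)" "rev (rotate t (rev x))"]
      by (simp only: rotate_neg) metis
  qed
  have "inj_on (\<lambda>x. rotate t (rev x)) ?A" by (rule inj_onI) (simp add: rotate_eq_iff)
  then have "card ((\<lambda>x. rotate t (rev x)) ` ?A) = card ?A" by (rule card_image)
  moreover have "(\<lambda>x. rotate t (rev x)) ` ?A = ?B"
  proof
    show "(\<lambda>x. rotate t (rev x)) ` ?A \<subseteq> ?B"
      using iff by (auto simp: sign_seqs_closed) (auto simp: sign_seqs_def)
    show "?B \<subseteq> (\<lambda>x. rotate t (rev x)) ` ?A"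
    proof
      fix y assume y: "y \<in> ?B"
      obtain j where j: "rotate j (rotate t y) = y" using rotate_back by blast
      define x where "x = rev (rotate j y)"
      have "rotate t (rev x) = y" using j by (simp add: x_def rotate_rotate add.commute)
      moreover have "x \<in> sign_seqs (2 * m)" using y by (simp add: x_def sign_seqs_closed)
      ultimately show "y \<in> (\<lambda>x. rotate t (rev x)) ` ?A"
        using iff[of x] y by (auto simp: sign_seqs_def image_iff)
    qed
  qed
  ultimately have "card ?A = card ?B" by (simp only:)
  then show ?thesis using True card_rev_eq_neg by simp
next
  case False
  have "rotate r (rev x) \<noteq> neg x" if x: "x \<in> sign_seqs (2 * m)" for x
  proof
    assume eq: "rotate r (rev x) = neg x"
    obtain t where t: "r = 2 * t + 1" using False by (rule oddE)
    \<comment> \<open>This is the solution of \<open>2 * m - Suc (r + i) = i\<close>, a fixed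
      position of the reflection.\<close>
    define i where "i = m - 1 - t"
    have i: "i < 2 * m" "r + i < 2 * m" "2 * m - Suc (r + i) = i"
      using assms t by (auto simp: i_def)
    have len: "length x = 2 * m" using x by (simp add: sign_seqs_def)
    have "rotate r (rev x) ! i = x ! i"
      using i len by (simp add: nth_rotate rev_nth)
    then have "x ! i = - (x ! i)" using eq i len by simp
    moreover have "x ! i \<in> {1, -1}"
      using x i(1) len nth_mem[of i x] unfolding sign_seqs_def by (metis (no_types, lifting) mem_Collect_eq subsetD)
    ultimately show False by auto
  qed
  then have "{x \<in> sign_seqs (2 * m). rotate r (rev x) = neg x} = {}" by blast
  then show ?thesis using False by (simp only: card.empty) simp
qed

text \<open>By \<open>card_rotations\<close> the sum counts pairs of a sequence and a reflection
  carrying it to its complement, divided by \<open>2 * m\<close>. Counted by reflections, each of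
  the \<open>m\<close> even values of \<open>r\<close> contributes \<open>2 ^ m\<close>.\<close>

lemma sum_reflection_self_complementary:
  assumes "0 < m"
  shows "(\<Sum>x\<in>sign_seqs (2 * m). if neg x \<in> necklace (rev x) then 1 / real (card (necklace x)) else 0)
    = 2 ^ m / 2"
proof -
  let ?X = "sign_seqs (2 * m)"
  have "(\<Sum>x\<in>?X. if neg x \<in> necklace (rev x) then 1 / real (card (necklace x)) else 0)
      = (\<Sum>x\<in>?X. real (card {r. r < 2 * m \<and> rotate r (rev x) = neg x}) / real (2 * m))"
  proof (rule sum.cong[OF refl])
    fix x assume "x \<in> ?X"
    then have "rev x \<in> ?X" by (simp add: sign_seqs_closed)
    have "0 < 2 * m" using assms by simp
    from card_rotations[OF \<open>rev x \<in> ?X\<close> this, of "neg x"]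
    show "(if neg x \<in> necklace (rev x) then 1 / real (card (necklace x)) else 0)
        = real (card {r. r < 2 * m \<and> rotate r (rev x) = neg x}) / real (2 * m)"
      by (simp only: card_necklace_rev)
  qed
  also have "\<dots> = real (\<Sum>x\<in>?X. card {r \<in> {..<2 * m}. rotate r (rev x) = neg x}) / real (2 * m)"
    by (simp add: sum_divide_distrib)
  also have "(\<Sum>x\<in>?X. card {r \<in> {..<2 * m}. rotate r (rev x) = neg x})
      = (\<Sum>r<2 * m. if even r then 2 ^ m else 0)"
    by (rule sum_multicount_gen) (use card_reflection_eq_neg finite_sign_seqs in auto)
  also have "\<dots> = m * 2 ^ m"
  proof -
    have "(\<Sum>r<2 * j. if even r then c else 0) = j * c" for j c :: nat
      by (induction j) auto
    then show ?thesis .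
  qed
  finally show ?thesis using assms by simp
qed

section \<open>Sign changes and complements reached by a rotation\<close>

text \<open>On sign functions the value is 1 exactly where the sign changes, so that
  \<open>num_ones\<close> counts sign changes.\<close>

definition differences :: "(nat \<Rightarrow> int) \<Rightarrow> nat \<Rightarrow> int" where
  "differences f i = - f i * f (Suc i)"

lemma sign_cases: "f \<in> periodic_signs n \<Longrightarrow> f i = 1 \<or> f i = - 1"
  by (simp add: periodic_signs_def)

lemma sign_square: "f \<in> periodic_signs n \<Longrightarrow> f i * f i = 1"
  using sign_cases[of f n i] by auto

text \<open>The sign changes determine a sign function up to a constant factor; evaluation at 0
  yields that factor.\<close>

lemma sign_shift:
  assumes "f \<in> periodic_signs n" "\<And>i. differences f (i + r) = differences f i"
  shows "f (i + r) = (f r * f 0) * f i"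
proof (induction i)
  case 0
  show ?case using sign_square[OF assms(1), of 0] by (simp add: mult.assoc)
next
  case (Suc i)
  have step: "f (Suc j) = - f j * differences f j" for j
    using sign_cases[OF assms(1), of j] by (auto simp: differences_def)
  have "f (Suc i + r) = - f (i + r) * differences f i"
    using step[of "i + r"] assms(2)[of i] by simp
  then show ?case using Suc step[of i] by simp
qed

lemma prod_neg_eq_power:
  fixes f :: "nat \<Rightarrow> int"
  assumes "\<And>i. f i = 1 \<or> f i = - 1"
  shows "(\<Prod>i<n. - f i) = (- 1) ^ card {i. i < n \<and> f i = 1}"
proof -
  have "(\<Prod>i<n. - f i) = (\<Prod>i<n. if f i = 1 then - 1 else 1)"
    using assms by (intro prod.cong) fastforce+
  also have "\<dots> = (\<Prod>i | i \<in> {..<n} \<and> f i = 1. - 1)"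
    by (rule prod.inter_filter[symmetric]) simp
  finally show ?thesis by simp
qed

text \<open>The product telescopes, since \<open>- differences f i = f i * f (Suc i)\<close>. With
  \<open>prod_neg_eq_power\<close> it shows that the number of changes in the first \<open>p\<close>
  steps is even iff \<open>f p = f 0\<close>.\<close>

lemma prod_differences:
  assumes "f \<in> periodic_signs n"
  shows "(\<Prod>i<p. - differences f i) = f 0 * f p"
proof (induction p)
  case 0
  show ?case using sign_square[OF assms] by simp
next
  case (Suc p)
  have "f 0 * f p * (f p * f (Suc p)) = f 0 * f (Suc p) * (f p * f p)" by simp
  then show ?case using Suc sign_square[OF assms, of p] by (simp add: differences_def)
qed

text \<open>A shift by the least period \<open>p\<close> of the changes multiplies \<open>f\<close>
  by a sign, and this sign must be negative. Hence \<open>2 * p\<close> is the least period of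
  \<open>f\<close>, it divides \<open>2 * m\<close>, and the number of changes in \<open>p\<close>
  steps is odd.\<close>

lemma antiperiodic_differences:
  assumes f: "f \<in> periodic_signs (2 * m)" and "0 < m" and anti: "\<And>i. f (i + r) = - f i"
  shows "least_period f = 2 * least_period (differences f)"
    "differences f \<in> periodic_signs m" "odd (num_ones (differences f))"
proof -
  let ?d = "differences f"
  have perf: "\<And>i. f (i + 2 * m) = f i" using f by (simp add: periodic_signs_def)
  have signd: "\<And>i. ?d i = 1 \<or> ?d i = - 1"
  proof -
    fix i
    show "?d i = 1 \<or> ?d i = - 1"
      using sign_cases[OF f, of i] sign_cases[OF f, of "Suc i"] by (auto simp: differences_def)
  qed
  have perd: "?d (i + 2 * m) = ?d i" for i
    using perf[of i] perf[of "Suc i"] by (simp add: differences_def)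
  have antid: "?d (i + r) = ?d i" for i
    using anti[of i] anti[of "Suc i"] by (simp add: differences_def)
  have dper: "0 < least_period ?d" "\<And>i. ?d (i + least_period ?d) = ?d i"
    "\<And>s. (\<forall>i. ?d (i + s) = ?d i) \<longleftrightarrow> least_period ?d dvd s"
    using least_period[of "2 * m" ?d] perd \<open>0 < m\<close> by auto
  have fper: "0 < least_period f" "\<And>i. f (i + least_period f) = f i"
    "\<And>s. (\<forall>i. f (i + s) = f i) \<longleftrightarrow> least_period f dvd s"
    using least_period[of "2 * m" f] perf \<open>0 < m\<close> by auto
  define p where "p = least_period ?d"
  have shift: "f (i + p) = (f p * f 0) * f i" for i
    using sign_shift[OF f, of p] dper(2) by (simp add: p_def)
  \<comment> \<open>A positive factor would make \<open>p\<close> a period of \<open>f\<close>, and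
    then also its multiple \<open>r\<close>, against antiperiodicity.\<close>
  have "f p * f 0 \<noteq> 1"
  proof
    assume "f p * f 0 = 1"
    then have "f (i + p) = f i" for i using shift[of i] by simp
    then have "least_period f dvd p" using fper(3)[of p] by blast
    moreover have "p dvd r" using dper(3)[of r] antid by (simp add: p_def)
    ultimately have "least_period f dvd r" by (rule dvd_trans)
    then have "f (0 + r) = f 0" using fper(3)[of r] by blast
    then show False using anti[of 0] sign_cases[OF f, of 0] by auto
  qed
  then have eps: "f p * f 0 = - 1" using sign_cases[OF f, of p] sign_cases[OF f, of 0] by auto
  then have antip: "f (i + p) = - f i" for i using shift[of i] by simp
  have "f (i + 2 * p) = f i" for i using antip[of i] antip[of "i + p"] by (simp add: mult_2 add.assoc)
  then have "least_period f dvd 2 * p" using fper(3) by blast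
  moreover have "p dvd least_period f"
  proof -
    have "?d (i + least_period f) = ?d i" for i
      using fper(2)[of i] fper(2)[of "Suc i"] by (simp add: differences_def)
    then show ?thesis using dper(3)[of "least_period f"] unfolding p_def by blast
  qed
  then obtain c where c: "least_period f = p * c" by (auto elim: dvdE)
  moreover have "0 < p" using dper(1) by (simp add: p_def)
  ultimately have "c dvd 2" by (simp add: mult.commute)
  then have "c \<le> 2" "c \<noteq> 0" by (cases "c = 0", auto dest: dvd_imp_le)+
  moreover have "c \<noteq> 1"
    using c fper(2)[of 0] antip[of 0] sign_cases[OF f, of 0] by auto
  ultimately have "c = 2" using \<open>c \<le> 2\<close> \<open>c \<noteq> 0\<close> by linarith
  then show per: "least_period f = 2 * least_period ?d" using c by (simp add: p_def)
  have "2 * p dvd 2 * m" using per fper(3)[of "2 * m"] perf p_def by auto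
  then have "p dvd m" by simp
  then have "\<forall>i. ?d (i + m) = ?d i" using dper(3)[of m] by (simp add: p_def)
  then show "?d \<in> periodic_signs m" using signd by (simp add: periodic_signs_def)
  have "(- 1) ^ num_ones ?d = f 0 * f p"
    using prod_neg_eq_power[of ?d p] prod_differences[OF f, of p] signd
    by (simp add: num_ones_def p_def)
  then have "(- 1 :: int) ^ num_ones ?d = - 1" using eps by (simp add: mult.commute)
  then show "odd (num_ones ?d)" by (metis one_neq_neg_one neg_one_even_power)
qed

text \<open>Recovers a sign function from its initial value \<open>s\<close> and its sign changes
  \<open>y\<close>.\<close>

definition integral_signs :: "int \<Rightarrow> (nat \<Rightarrow> int) \<Rightarrow> nat \<Rightarrow> int" where
  "integral_signs s y i = s * (\<Prod>j<i. - y j)"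

text \<open>An odd number of changes flips the sign after each least period of \<open>y\<close>. Two
  such periods restore it, and \<open>2 * m\<close> is a multiple of their length.\<close>

lemma integral_signs:
  assumes y: "y \<in> periodic_signs m" and "0 < m" "odd (num_ones y)" "s = 1 \<or> s = - 1"
  shows "integral_signs s y \<in> periodic_signs (2 * m)"
    "integral_signs s y (i + least_period y) = - integral_signs s y i"
    "differences (integral_signs s y) = y"
proof -
  let ?f = "integral_signs s y" and ?p = "least_period y"
  have rec: "?f (Suc i) = ?f i * - y i" for i by (simp add: integral_signs_def)
  have sign: "?f i = 1 \<or> ?f i = - 1" for i
  proof (induction i)
    case 0
    show ?case using assms(4) by (simp add: integral_signs_def)
  next
    case (Suc i)
    then show ?case using sign_cases[OF y, of i] by (auto simp: rec)
  qed
  have per: "y (i + m) = y i" for i using y by (simp add: periodic_signs_def)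
  have anti: "?f (i + ?p) = - ?f i" for i
  proof (induction i)
    case 0
    have "(\<Prod>j<?p. - y j) = - 1"
      using prod_neg_eq_power[of y ?p] sign_cases[OF y] assms(3) by (simp add: num_ones_def)
    then show ?case by (simp add: integral_signs_def)
  next
    case (Suc i)
    then show ?case
      using least_period(2)[of m y i] assms(2) per by (simp add: rec)
  qed
  then show "?f (i + ?p) = - ?f i" .
  have "?f (i + 2 * ?p) = ?f i" for i using anti[of i] anti[of "i + ?p"] by (simp add: mult_2 add.assoc)
  then have "?f (i + 2 * ?p * q) = ?f i" for i q by (rule period_mult)
  moreover obtain q where "m = ?p * q" using least_period_dvd[OF y assms(2)] by (auto elim: dvdE)
  ultimately have "?f (i + 2 * m) = ?f i" for i by (metis mult.assoc)
  then show "?f \<in> periodic_signs (2 * m)" using sign by (simp add: periodic_signs_def)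
  show "differences ?f = y"
  proof
    fix i
    show "differences ?f i = y i" using sign[of i] by (auto simp: differences_def rec)
  qed
qed

lemma integral_differences:
  assumes "f \<in> periodic_signs n"
  shows "integral_signs (f 0) (differences f) = f"
proof
  fix i
  show "integral_signs (f 0) (differences f) i = f i"
    using prod_differences[OF assms, of i] sign_cases[OF assms, of 0]
    by (auto simp: integral_signs_def)
qed

text \<open>The map \<open>f \<mapsto> (differences f, f 0)\<close> is a bijection that halves the least period.\<close>

lemma sum_rotation_self_complementary:
  assumes "0 < m"
  shows "(\<Sum>x\<in>sign_seqs (2 * m). if neg x \<in> necklace x then 1 / real (card (necklace x)) else 0)
    = (\<Sum>y | y \<in> periodic_signs m \<and> odd (num_ones y). 1 / real (least_period y))"
proof -
  let ?anti = "\<lambda>f :: nat \<Rightarrow> int. \<exists>r. \<forall>i. f (i + r) = - f i"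
  let ?A = "{f \<in> periodic_signs (2 * m). ?anti f}"
  let ?Y = "{y \<in> periodic_signs m. odd (num_ones y)}"
  have pos: "0 < 2 * m" using assms by simp
  have iff: "neg x \<in> necklace x \<longleftrightarrow> ?anti (cyc x)" if x: "x \<in> sign_seqs (2 * m)" for x
  proof -
    have ne: "x \<noteq> []" using x pos by (auto simp: sign_seqs_def)
    have "neg x = rotate r x \<longleftrightarrow> (\<forall>i. cyc x (i + r) = - cyc x i)" for r
    proof
      assume "neg x = rotate r x"
      then show "\<forall>i. cyc x (i + r) = - cyc x i" using cyc_rotate[OF ne] cyc_neg[OF ne] by metis
    next
      assume "\<forall>i. cyc x (i + r) = - cyc x i"
      then show "neg x = rotate r x" by (intro cyc_inject) (simp_all add: cyc_rotate ne cyc_neg)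
    qed
    then show ?thesis by (auto simp: necklace_def)
  qed
  have "(\<Sum>x\<in>sign_seqs (2 * m). if neg x \<in> necklace x then 1 / real (card (necklace x)) else 0)
      = (\<Sum>x\<in>sign_seqs (2 * m). if ?anti (cyc x) then 1 / real (least_period (cyc x)) else 0)"
    by (intro sum.cong refl) (simp only: iff card_necklace[OF _ pos])
  also have "\<dots> = (\<Sum>f\<in>periodic_signs (2 * m). if ?anti f then 1 / real (least_period f) else 0)"
    by (rule sum.reindex_bij_betw[OF cyc_bij[OF pos]])
  also have "\<dots> = (\<Sum>f\<in>?A. 1 / real (least_period f))"
    by (rule sum.inter_filter[symmetric]) (rule finite_periodic_signs[OF pos])
  \<comment> \<open>The doubled period halves each weight, and the two initial values
    \<open>s\<close> make up for it.\<close>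
  also have "\<dots> = (\<Sum>(y, s)\<in>?Y \<times> {1, - 1 :: int}. 1 / (2 * real (least_period y)))"
  proof (rule sum.reindex_bij_witness[of _ "\<lambda>(y, s). integral_signs s y" "\<lambda>f. (differences f, f 0)"])
    fix f assume f: "f \<in> ?A"
    then obtain r where r: "\<And>i. f (i + r) = - f i" by blast
    have "f \<in> periodic_signs (2 * m)" using f by blast
    note anti = antiperiodic_differences[of f m r, OF this assms r]
    show "(case (differences f, f 0) of (y, s) \<Rightarrow> integral_signs s y) = f"
      using f integral_differences by auto
    show "(differences f, f 0) \<in> ?Y \<times> {1, - 1}" using f anti sign_cases by blast
    show "(case (differences f, f 0) of (y, s) \<Rightarrow> 1 / (2 * real (least_period y)))
        = 1 / real (least_period f)"
      using f anti(1) by simp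
  next
    fix z assume "z \<in> ?Y \<times> {1, - 1 :: int}"
    then obtain y s where z: "z = (y, s)" and y: "y \<in> periodic_signs m" "odd (num_ones y)"
      and s: "s = 1 \<or> s = - 1" by auto
    note int = integral_signs[OF y(1) assms y(2) s]
    show "(\<lambda>f. (differences f, f 0)) (case z of (y, s) \<Rightarrow> integral_signs s y) = z"
      using int(3) z by (simp add: integral_signs_def)
    show "(case z of (y, s) \<Rightarrow> integral_signs s y) \<in> ?A"
      using int(1,2) unfolding z prod.case by blast
  qed
  also have "\<dots> = (\<Sum>y\<in>?Y. \<Sum>s\<in>{1, - 1 :: int}. 1 / (2 * real (least_period y)))"
    by (rule sum.cartesian_product[symmetric])
  also have "\<dots> = (\<Sum>y\<in>?Y. 1 / real (least_period y))"
    by (simp add: field_simps)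
  finally show ?thesis by simp
qed

lemma sum_self_complementary:
  assumes "0 < m"
  shows "(\<Sum>x\<in>sign_seqs (2 * m). if neg x \<in> bracelet x then 1 / real (card (bracelet x)) else 0)
    = 2 ^ m / 4 + 1 / 2 * (\<Sum>y | y \<in> periodic_signs m \<and> odd (num_ones y). 1 / real (least_period y))"
proof -
  have "(\<Sum>x\<in>sign_seqs (2 * m). if neg x \<in> bracelet x then 1 / real (card (bracelet x)) else 0)
    = (\<Sum>x\<in>sign_seqs (2 * m).
        1 / 2 * (if neg x \<in> necklace x then 1 / real (card (necklace x)) else 0)
      + 1 / 2 * (if neg x \<in> necklace (rev x) then 1 / real (card (necklace x)) else 0))"
    by (intro sum.cong refl inverse_card_bracelet)
  also have "\<dots> = 1 / 2 * (\<Sum>x\<in>sign_seqs (2 * m). if neg x \<in> necklace x then 1 / real (card (necklace x)) else 0)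
      + 1 / 2 * (\<Sum>x\<in>sign_seqs (2 * m). if neg x \<in> necklace (rev x) then 1 / real (card (necklace x)) else 0)"
    by (simp only: sum.distrib sum_distrib_left)
  finally show ?thesis
    using sum_rotation_self_complementary[OF assms] sum_reflection_self_complementary[OF assms] by simp
qed

subsection \<open>Lyndon words\<close>

lemma count_list_cyc:
  assumes "length x = n"
  shows "count_list x 1 = card {i. i < n \<and> cyc x i = 1}"
proof -
  have "count_list x 1 = card {i. i < length x \<and> 1 = x ! i}"
    by (simp add: count_list_eq_length_filter length_filter_conv_card)
  also have "{i. i < length x \<and> 1 = x ! i} = {i. i < n \<and> cyc x i = 1}"
    using assms by (auto simp: cyc_def)
  finally show ?thesis .
qed

lemma aperiodic_iff:
  assumes "x \<in> sign_seqs n" "0 < n"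
  shows "aperiodic x \<longleftrightarrow> least_period (cyc x) = n"
proof -
  let ?p = "least_period (cyc x)"
  have len: "length x = n" using assms by (simp add: sign_seqs_def)
  have dvd: "?p dvd n" using least_period_dvd cyc_in assms by blast
  have pos: "0 < ?p" using least_period_pos cyc_in assms by blast
  have fixed: "rotate i x = x \<longleftrightarrow> ?p dvd i" for i
    using rotate_eq_rotate_iff[OF assms, of i 0] by auto
  show ?thesis
  proof
    assume "aperiodic x"
    then have "\<not> ?p < n" using fixed[of ?p] pos len by (auto simp: aperiodic_def)
    then show "?p = n" using dvd assms(2) by (simp add: dvd_imp_le le_antisym)
  next
    assume "?p = n"
    then show "aperiodic x" using fixed len by (auto simp: aperiodic_def dest: dvd_imp_le)
  qed
qed

text \<open>A necklace of an aperiodic word of length \<open>p\<close> has exactly \<open>p\<close>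
  members, so every weight is \<open>1 / p\<close>.\<close>

lemma L_eq_sum:
  assumes "0 < p"
  shows "real (L p k)
    = (\<Sum>f | f \<in> periodic_signs p \<and> least_period f = p \<and> num_ones f = k. 1 / real p)"
proof -
  let ?X = "{s \<in> sign_seqs p. count_list s 1 = k \<and> aperiodic s}"
  let ?Y = "{f \<in> periodic_signs p. least_period f = p \<and> num_ones f = k}"
  have closed: "necklace x \<subseteq> ?X" if x: "x \<in> ?X" for x
  proof
    fix y assume y: "y \<in> necklace x"
    then obtain r where r: "y = rotate r x" by (auto simp: necklace_def)
    have mem: "y \<in> sign_seqs p" using x r sign_seqs_closed(1) by blast
    have "count_list y 1 = k" using x r dihedral_move_invariant[OF dihedral_move.shift] by blast
    moreover have "card (necklace y) = p"
      using x aperiodic_iff[of x p] card_necklace[of x p] assms necklace_eq[OF y] by simp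
    then have "aperiodic y" using aperiodic_iff[OF mem assms] card_necklace[OF mem assms] by simp
    ultimately show "y \<in> ?X" using mem by blast
  qed
  have "real (L p k) = (\<Sum>x\<in>?X. 1 / real (card (necklace_rel `` {x})))"
    unfolding L_def
    by (intro card_quotient_eq_sum equiv_necklace_rel)
      (use closed finite_sign_seqs in \<open>simp_all add: necklace_rel_image\<close>)
  also have "\<dots> = (\<Sum>x\<in>?X. 1 / real p)"
  proof (rule sum.cong[OF refl])
    fix x assume "x \<in> ?X"
    then have "card (necklace x) = p" using aperiodic_iff[of x p] card_necklace[of x p] assms by simp
    then show "1 / real (card (necklace_rel `` {x})) = 1 / real p" by (simp add: necklace_rel_image)
  qed
  also have "card ?X = card ?Y"
  proof -
    have "cyc ` ?X = ?Y"
    proof -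
      have "x \<in> ?X \<longleftrightarrow> least_period (cyc x) = p \<and> num_ones (cyc x) = k" if "x \<in> sign_seqs p" for x
        using that aperiodic_iff[OF that assms] count_list_cyc[of x p]
        by (auto simp: num_ones_def sign_seqs_def)
      then have "?X = {x \<in> sign_seqs p. least_period (cyc x) = p \<and> num_ones (cyc x) = k}"
        by blast
      moreover have "periodic_signs p = cyc ` sign_seqs p"
        using bij_betw_imp_surj_on[OF cyc_bij[OF assms]] by (rule sym)
      ultimately show ?thesis by (simp only:) blast
    qed
    moreover have "inj_on cyc ?X"
      using bij_betw_imp_inj_on[OF cyc_bij[OF assms]] by (rule inj_on_subset) blast
    then have "card (cyc ` ?X) = card ?X" by (rule card_image)
    ultimately show ?thesis by (simp only:)
  qed
  then have "(\<Sum>x\<in>?X. 1 / real p) = (\<Sum>f\<in>?Y. 1 / real p)" by simp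
  finally show ?thesis .
qed

text \<open>Substitutes \<open>p = m div l\<close> and replaces \<open>k\<close> by
  \<open>k div l\<close>; the ceiling depends only on the latter quotient.\<close>

lemma F_reindex:
  assumes "0 < m"
  shows "F (2 * m) = (\<Sum>p | p dvd m. \<Sum>k = 1..p. L p k * nat \<lceil>real k / 2\<rceil>)"
proof -
  let ?A = "SIGMA k:{1..m}. {l. l dvd gcd m k}"
  let ?B = "SIGMA p:{p. p dvd m}. {1..p}"
  have "F (2 * m) = (\<Sum>k = 1..m. \<Sum>l | l dvd gcd m k. L (m div l) (k div l) * nat \<lceil>real k / (2 * real l)\<rceil>)"
    by (simp add: F_def)
  also have "\<dots> = (\<Sum>(k, l)\<in>?A. L (m div l) (k div l) * nat \<lceil>real k / (2 * real l)\<rceil>)"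
    by (rule sum.Sigma) (use assms in auto)
  also have "\<dots> = (\<Sum>(p, k)\<in>?B. L p k * nat \<lceil>real k / 2\<rceil>)"
  proof (rule sum.reindex_bij_witness[of _ "\<lambda>(p, k). (k * (m div p), m div p)" "\<lambda>(k, l). (m div l, k div l)"])
    fix z assume "z \<in> ?A"
    then obtain k l where z: "z = (k, l)" and k: "1 \<le> k" "k \<le> m" and l: "l dvd m" "l dvd k" by auto
    obtain p where p: "m = l * p" using l(1) by (auto elim: dvdE)
    obtain j where j: "k = l * j" using l(2) by (auto elim: dvdE)
    have pos: "0 < l" "0 < p" "0 < j" using p j k assms by auto
    show "(\<lambda>(p, k). (k * (m div p), m div p)) (case z of (k, l) \<Rightarrow> (m div l, k div l)) = z"
      using z p j pos by simp
    show "(case z of (k, l) \<Rightarrow> (m div l, k div l)) \<in> ?B"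
      using z p j pos k by simp
    have "real k / (2 * real l) = real (k div l) / 2" using j pos by simp
    then show "(case case z of (k, l) \<Rightarrow> (m div l, k div l) of (p, k) \<Rightarrow> L p k * nat \<lceil>real k / 2\<rceil>)
        = (case z of (k, l) \<Rightarrow> L (m div l) (k div l) * nat \<lceil>real k / (2 * real l)\<rceil>)"
      by (simp only: z prod.case)
  next
    fix z assume "z \<in> ?B"
    then obtain p k where z: "z = (p, k)" and p: "p dvd m" and k: "1 \<le> k" "k \<le> p" by auto
    obtain l where l: "m = p * l" using p by (auto elim: dvdE)
    have pos: "0 < l" "0 < p" using l assms by auto
    show "(\<lambda>(k, l). (m div l, k div l)) (case z of (p, k) \<Rightarrow> (k * (m div p), m div p)) = z"
      using z l pos by simp
    show "(case z of (p, k) \<Rightarrow> (k * (m div p), m div p)) \<in> ?A"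
      using z l pos k by simp
  qed
  also have "\<dots> = (\<Sum>p | p dvd m. \<Sum>k = 1..p. L p k * nat \<lceil>real k / 2\<rceil>)"
    by (rule sum.Sigma[symmetric]) (use assms in auto)
  finally show ?thesis .
qed

lemma nat_ceiling_half: "real (nat \<lceil>real k / 2\<rceil>) = (real k + (if odd k then 1 else 0)) / 2"
proof (cases "even k")
  case True
  then show ?thesis by (auto elim!: evenE)
next
  case False
  then obtain j where j: "k = 2 * j + 1" by (rule oddE)
  have "\<lceil>real k / 2\<rceil> = int j + 1" unfolding j by (rule ceiling_unique) auto
  then show ?thesis using j by simp
qed

lemma num_ones_le: "num_ones f \<le> least_period f"
  unfolding num_ones_def using card_mono[of "{..<least_period f}"] by (metis (no_types, lifting) card_lessThan finite_lessThan lessThan_iff mem_Collect_eq subsetI)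

text \<open>Grouping \<open>periodic_signs m\<close> by least period and then by number of ones
  reproduces the double sum, by \<open>L_eq_sum\<close>.\<close>

lemma F_eq_sum:
  assumes "0 < m"
  shows "real (F (2 * m))
    = (\<Sum>f\<in>periodic_signs m. real (nat \<lceil>real (num_ones f) / 2\<rceil>) / real (least_period f))"
proof -
  let ?c = "\<lambda>k. real (nat \<lceil>real k / 2\<rceil>)"
  have fin: "finite (periodic_signs m)" using finite_periodic_signs assms by blast
  have inner: "(\<Sum>k = 1..p. real (L p k) * ?c k)
      = (\<Sum>f | f \<in> periodic_signs m \<and> least_period f = p. ?c (num_ones f) / real (least_period f))"
    if p: "p dvd m" for p
  proof -
    let ?Z = "{f \<in> periodic_signs m. least_period f = p}"
    have pos: "0 < p" using p assms by (auto intro: Nat.gr0I)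
    have Z: "?Z = {f \<in> periodic_signs p. least_period f = p}"
    proof -
      have "f \<in> periodic_signs m \<longleftrightarrow> f \<in> periodic_signs p" if "least_period f = p" for f
        using that p pos assms periodic_signs_iff[of f m p] periodic_signs_iff[of f p m] by auto
      then show ?thesis by blast
    qed
    \<comment> \<open>The added term is zero because its ceiling is; with it the range covers all
      values of \<open>num_ones\<close>.\<close>
    have "(\<Sum>k = 1..p. real (L p k) * ?c k) = (\<Sum>k = 0..p. real (L p k) * ?c k)"
      by (rule sum.mono_neutral_left) (auto simp: not_less_eq_eq)
    also have "\<dots> = (\<Sum>k = 0..p. \<Sum>f | f \<in> ?Z \<and> num_ones f = k. ?c (num_ones f) / real (least_period f))"
    proof (rule sum.cong[OF refl])
      fix k
      have "(\<Sum>f | f \<in> ?Z \<and> num_ones f = k. ?c (num_ones f) / real (least_period f))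
          = (\<Sum>f | f \<in> ?Z \<and> num_ones f = k. 1 / real p * ?c k)"
        by (intro sum.cong) auto
      also have "\<dots> = real (L p k) * ?c k"
        unfolding L_eq_sum[OF pos] Z by (simp add: sum_distrib_right conj_assoc)
      finally show "real (L p k) * ?c k
          = (\<Sum>f | f \<in> ?Z \<and> num_ones f = k. ?c (num_ones f) / real (least_period f))" by simp
    qed
    also have "\<dots> = (\<Sum>f\<in>?Z. ?c (num_ones f) / real (least_period f))"
      by (rule sum.group) (use fin num_ones_le in auto)
    finally show ?thesis .
  qed
  have "real (F (2 * m)) = (\<Sum>p | p dvd m. \<Sum>k = 1..p. real (L p k) * ?c k)"
    by (simp add: F_reindex[OF assms])
  also have "\<dots> = (\<Sum>p | p dvd m. \<Sum>f | f \<in> periodic_signs m \<and> least_period f = p. ?c (num_ones f) / real (least_period f))"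
    by (intro sum.cong refl inner) simp
  also have "\<dots> = (\<Sum>f\<in>periodic_signs m. ?c (num_ones f) / real (least_period f))"
    by (rule sum.group) (use fin assms least_period_dvd in auto)
  finally show ?thesis .
qed

text \<open>The densities of ones in \<open>f\<close> and in its complement add up to 1, so the
  average over the \<open>2 ^ m\<close> functions is one half.\<close>

lemma sum_num_ones:
  assumes "0 < m"
  shows "(\<Sum>f\<in>periodic_signs m. real (num_ones f) / real (least_period f)) = 2 ^ m / 2"
proof -
  let ?g = "\<lambda>f. real (num_ones f) / real (least_period f)"
  have compl: "?g f + ?g (\<lambda>i. - f i) = 1" if f: "f \<in> periodic_signs m" for f
  proof -
    have per: "least_period (\<lambda>i. - f i) = least_period f" by (simp add: least_period_def)
    have "{i. i < least_period f \<and> f i = 1} \<union> {i. i < least_period f \<and> - f i = 1} = {..<least_period f}"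
      using sign_cases[OF f] by fastforce
    moreover have "{i. i < least_period f \<and> f i = 1} \<inter> {i. i < least_period f \<and> - f i = 1} = {}"
      by auto
    ultimately have "num_ones f + num_ones (\<lambda>i. - f i) = least_period f"
      unfolding num_ones_def per by (metis (no_types, lifting) card_Un_disjoint card_lessThan finite_Un finite_lessThan)
    moreover have "0 < least_period f" using least_period_pos f assms by blast
    ultimately show ?thesis unfolding per
      by (metis add_divide_distrib divide_self of_nat_0_less_iff of_nat_add less_irrefl)
  qed
  have "(\<Sum>f\<in>periodic_signs m. ?g f) = (\<Sum>f\<in>periodic_signs m. ?g (\<lambda>i. - f i))"
    by (rule sum.reindex_bij_witness[of _ "\<lambda>f i. - f i" "\<lambda>f i. - f i"])
      (auto simp: periodic_signs_def)
  then have "2 * (\<Sum>f\<in>periodic_signs m. ?g f) = (\<Sum>f\<in>periodic_signs m. ?g f + ?g (\<lambda>i. - f i))"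
    by (simp add: sum.distrib)
  also have "\<dots> = (\<Sum>f\<in>periodic_signs m. 1)" by (intro sum.cong refl compl)
  finally show ?thesis using card_periodic_signs[OF assms] by simp
qed

text \<open>The right-hand side is the number of bracelets that equal their complement.\<close>

lemma F_eq_self_complementary:
  assumes "0 < m"
  shows "real (F (2 * m))
    = (\<Sum>x\<in>sign_seqs (2 * m). if neg x \<in> bracelet x then 1 / real (card (bracelet x)) else 0)"
proof -
  have "real (F (2 * m)) = (\<Sum>f\<in>periodic_signs m.
      1 / 2 * (real (num_ones f) / real (least_period f))
      + 1 / 2 * (if odd (num_ones f) then 1 / real (least_period f) else 0))"
    unfolding F_eq_sum[OF assms] nat_ceiling_half
    by (intro sum.cong refl) (simp add: add_divide_distrib)
  also have "\<dots> = 1 / 2 * (\<Sum>f\<in>periodic_signs m. real (num_ones f) / real (least_period f))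
      + 1 / 2 * (\<Sum>f\<in>periodic_signs m. if odd (num_ones f) then 1 / real (least_period f) else 0)"
    by (simp only: sum.distrib sum_distrib_left)
  also have "(\<Sum>f\<in>periodic_signs m. if odd (num_ones f) then 1 / real (least_period f) else 0)
      = (\<Sum>f | f \<in> periodic_signs m \<and> odd (num_ones f). 1 / real (least_period f))"
    by (rule sum.inter_filter[symmetric]) (rule finite_periodic_signs[OF assms])
  finally show ?thesis
    using sum_self_complementary[OF assms] sum_num_ones[OF assms] by simp
qed

subsection \<open>Counting flexagon classes\<close>

lemma sum_list_count:
  assumes "x \<in> sign_seqs n"
  shows "sum_list x = 2 * int (count_list x 1) - int n"
proof -
  have "sum_list x = 2 * int (count_list x 1) - int (length x)" if "set x \<subseteq> {1, -1}" for x
    using that by (induction x) auto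
  then show ?thesis using assms by (simp add: sign_seqs_def)
qed

lemma count_list_le: "x \<in> sign_seqs n \<Longrightarrow> count_list x 1 \<le> n"
  using count_le_length[of x 1] by (simp add: sign_seqs_def)

lemma count_list_neg:
  assumes "x \<in> sign_seqs n"
  shows "count_list (neg x) 1 = n - count_list x 1"
  using sum_list_count[OF assms] sum_list_count[of "neg x" n] assms sum_list_neg[of x]
  by (simp add: sign_seqs_closed)

text \<open>Not a number of classes in general: a class containing sequences with \<open>k\<close>
  ones also contains some with \<open>n - k\<close>, and its total weight 1 is shared between
  them.\<close>

definition class_weight :: "nat \<Rightarrow> nat \<Rightarrow> real" where
  "class_weight n k = (\<Sum>x | x \<in> sign_seqs n \<and> count_list x 1 = k. 1 / real (card (flexagon_rel `` {x})))"

lemma B_eq_sum: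
  "real (B n k) = (\<Sum>x | x \<in> sign_seqs n \<and> count_list x 1 = k. 1 / real (card (bracelet x)))"
  unfolding B_def bracelet_rel_image[symmetric]
  by (intro card_quotient_eq_sum equiv_bracelet_rel)
    (use bracelet_rel_invariant finite_sign_seqs in auto)

text \<open>The correction term counts half of the self-complementary bracelets. Such a bracelet has
  as many ones as minus ones, so for \<open>2 * k = n\<close> all of them occur and otherwise
  none.\<close>

lemma class_weight_eq:
  assumes "0 < n"
  shows "class_weight n k = real (B n k) / 2 + (if 2 * k = n then real (F n) / 2 else 0)"
proof -
  let ?X = "{x \<in> sign_seqs n. count_list x 1 = k}"
  let ?h = "\<lambda>x. if neg x \<in> bracelet x then 1 / real (card (bracelet x)) else 0"
  have half: "2 * count_list x 1 = n" if "x \<in> sign_seqs n" "neg x \<in> bracelet x" for x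
  proof -
    have "count_list (neg x) 1 = count_list x 1"
      using that(2) bracelet_rel_invariant[of x "neg x"] bracelet_rel_image[of x] by auto
    then show ?thesis using count_list_neg[OF that(1)] count_list_le[OF that(1)] by simp
  qed
  have "class_weight n k = (\<Sum>x\<in>?X. 1 / 2 * (1 / real (card (bracelet x))) + 1 / 2 * ?h x)"
    unfolding class_weight_def by (intro sum.cong refl inverse_card_flexagon_class[of _ n]) simp
  also have "\<dots> = 1 / 2 * real (B n k) + 1 / 2 * (\<Sum>x\<in>?X. ?h x)"
    unfolding B_eq_sum by (simp only: sum.distrib sum_distrib_left)
  also have "(\<Sum>x\<in>?X. ?h x) = (if 2 * k = n then real (F n) else 0)"
  proof (cases "2 * k = n")
    case True
    have "(\<Sum>x\<in>?X. ?h x) = (\<Sum>x\<in>sign_seqs n. ?h x)"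
      by (rule sum.mono_neutral_left) (use finite_sign_seqs half True in auto)
    then show ?thesis using True assms F_eq_self_complementary[of k] by auto
  next
    case ne: False
    have "(\<Sum>x\<in>?X. ?h x) = (\<Sum>x\<in>?X. 0)" by (intro sum.cong refl) (use half ne in auto)
    then show ?thesis using ne by simp
  qed
  finally show ?thesis by simp
qed

lemma class_weight_sym:
  assumes "k \<le> n"
  shows "class_weight n (n - k) = class_weight n k"
  unfolding class_weight_def
proof (rule sum.reindex_bij_witness[of _ neg neg])
  fix x assume "x \<in> {x \<in> sign_seqs n. count_list x 1 = n - k}"
  then show "neg (neg x) = x" "neg x \<in> {x \<in> sign_seqs n. count_list x 1 = k}"
    "1 / real (card (flexagon_rel `` {neg x})) = 1 / real (card (flexagon_rel `` {x}))"
    using assms count_list_neg[of x n] by (simp_all add: sign_seqs_closed flexagon_rel_image Un_commute)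
next
  fix x assume "x \<in> {x \<in> sign_seqs n. count_list x 1 = k}"
  then show "neg (neg x) = x" "neg x \<in> {x \<in> sign_seqs n. count_list x 1 = n - k}"
    using count_list_neg[of x n] by (simp_all add: sign_seqs_closed)
qed

lemma sum_symmetric:
  fixes w :: "nat \<Rightarrow> real"
  assumes "finite K" and K: "\<And>k. k \<in> K \<Longrightarrow> k \<le> n \<and> n - k \<in> K \<and> w (n - k) = w k"
  shows "sum w K = sum w {k \<in> K. 2 * k = n} + 2 * sum w {k \<in> K. n < 2 * k}"
proof -
  let ?lo = "{k \<in> K. 2 * k < n}" and ?eq = "{k \<in> K. 2 * k = n}" and ?hi = "{k \<in> K. n < 2 * k}"
  have "K = ?lo \<union> (?eq \<union> ?hi)" by auto
  then have "sum w K = sum w (?lo \<union> (?eq \<union> ?hi))" by (rule arg_cong)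
  also have "\<dots> = sum w ?lo + sum w (?eq \<union> ?hi)"
    by (rule sum.union_disjoint) (use assms(1) in auto)
  also have "sum w (?eq \<union> ?hi) = sum w ?eq + sum w ?hi"
    by (rule sum.union_disjoint) (use assms(1) in auto)
  also have "sum w ?lo = sum w ?hi"
  proof (rule sum.reindex_bij_witness[of _ "\<lambda>k. n - k" "\<lambda>k. n - k"])
    fix k
    show "n - (n - k) = k" "n - k \<in> ?hi" "w (n - k) = w k" if "k \<in> ?lo"
    proof -
      have "n < 2 * (n - k)" using that by auto
      then show "n - (n - k) = k" "n - k \<in> ?hi" "w (n - k) = w k" using K[of k] that by simp_all
    qed
    show "n - (n - k) = k" "n - k \<in> ?lo" if "k \<in> ?hi"
    proof -
      have "2 * (n - k) < n" using that K[of k] by auto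
      then show "n - (n - k) = k" "n - k \<in> ?lo" using K[of k] that by simp_all
    qed
  qed
  finally show ?thesis by simp
qed

text \<open>The map \<open>k \<mapsto> n - k\<close> only changes the sign of
  \<open>2 * int k - int n\<close>, so the sum folds at the middle. Above the middle, twice the
  weight is exactly \<open>B n k\<close>.\<close>

lemma sum_class_weight:
  assumes "0 < n"
  shows "(\<Sum>k | k \<le> n \<and> 3 dvd 2 * int k - int n. class_weight n k)
    = (if even n then real (B n (n div 2)) / 2 + real (F n) / 2 else 0)
      + (\<Sum>k | k \<le> n \<and> n < 2 * k \<and> 3 dvd 2 * int k - int n. real (B n k))"
proof -
  define K where "K = {k. k \<le> n \<and> 3 dvd 2 * int k - int n}"
  let ?eq = "{k \<in> K. 2 * k = n}" and ?hi = "{k \<in> K. n < 2 * k}"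
  have "finite K" by (simp add: K_def)
  moreover have "k \<le> n \<and> n - k \<in> K \<and> class_weight n (n - k) = class_weight n k" if "k \<in> K" for k
  proof -
    have le: "k \<le> n" and dvd: "3 dvd 2 * int k - int n" using that by (auto simp: K_def)
    have "2 * int (n - k) - int n = - (2 * int k - int n)" using le by simp
    then have "3 dvd 2 * int (n - k) - int n" using dvd by (simp only: dvd_minus_iff)
    then show ?thesis using le class_weight_sym[OF le] by (simp add: K_def)
  qed
  ultimately have "sum (class_weight n) K = sum (class_weight n) ?eq + 2 * sum (class_weight n) ?hi"
    by (rule sum_symmetric)
  also have "sum (class_weight n) ?eq = (if even n then real (B n (n div 2)) / 2 + real (F n) / 2 else 0)"
  proof (cases "even n")
    case True
    then have "?eq = {n div 2}" by (auto simp: K_def)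
    then show ?thesis using True class_weight_eq[OF assms, of "n div 2"] by simp
  next
    case False
    then have "?eq = {}" by auto
    then have "sum (class_weight n) ?eq = 0" by (simp only: sum.empty)
    then show ?thesis using False by simp
  qed
  also have "2 * sum (class_weight n) ?hi = (\<Sum>k\<in>?hi. real (B n k))"
    unfolding sum_distrib_left
    by (intro sum.cong refl) (simp add: class_weight_eq[OF assms])
  also have "?hi = {k. k \<le> n \<and> n < 2 * k \<and> 3 dvd 2 * int k - int n}"
    unfolding K_def by blast
  finally show ?thesis by (simp only: K_def)
qed

text \<open>For even \<open>n\<close> there are two alternating sequences, negatives of each other
  and hence in one class. For odd \<open>n\<close> there is none, since rotation preserves the sum,
  which would have to vanish.\<close>

lemma sum_alternating:
  assumes "0 < n"
  shows "(\<Sum>x | x \<in> sign_seqs n \<and> rotate1 x = neg x. 1 / real (card (flexagon_rel `` {x})))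
    = (if even n then 1 else 0)"
proof -
  let ?A = "{x \<in> sign_seqs n. rotate1 x = neg x}"
  show ?thesis
  proof (cases "even n")
    case False
    have "?A = {}"
    proof (rule ccontr)
      assume "?A \<noteq> {}"
      then obtain x where x: "x \<in> sign_seqs n" "rotate1 x = neg x" by blast
      then have "sum_list x = - sum_list x" using sum_list_rotate[of 1 x] by (simp add: sum_list_neg)
      then show False using sum_list_count[OF x(1)] False by presburger
    qed
    then show ?thesis using False by (simp only: sum.empty) simp
  next
    case True
    let ?f = "\<lambda>i. (- 1 :: int) ^ i"
    have "?f \<in> periodic_signs n"
      using True by (auto simp: periodic_signs_def power_add) (metis neg_one_even_power neg_one_odd_power)
    then obtain x0 where x0: "x0 \<in> sign_seqs n" "cyc x0 = ?f"
      using bij_betw_imp_surj_on[OF cyc_bij[OF assms]] by (metis imageE)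
    have ne: "x \<noteq> []" if "x \<in> sign_seqs n" for x using that assms by (auto simp: sign_seqs_def)
    have "rotate 1 x0 = neg x0"
      by (rule cyc_inject) (simp_all only: cyc_rotate[OF ne[OF x0(1)]] cyc_neg[OF ne[OF x0(1)]] x0(2), simp_all)
    then have x0A: "x0 \<in> ?A" using x0(1) by simp
    have same: "y = x0 \<or> y = neg x0" if y: "y \<in> ?A" for y
    proof -
      have "cyc (rotate 1 y) i = cyc (neg y) i" for i using y by simp
      then have step: "cyc y (Suc i) = - cyc y i" for i
        using cyc_rotate[OF ne, of y 1 i] cyc_neg[OF ne, of y i] y by simp
      have alt: "cyc y i = cyc y 0 * cyc x0 i" for i
        by (induction i) (use step x0(2) in auto)
      have "cyc y 0 = 1 \<or> cyc y 0 = - 1" using cyc_sign[of y n 0] y assms by blast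
      then show ?thesis
      proof
        assume "cyc y 0 = 1"
        then have "cyc y i = cyc x0 i" for i using alt[of i] by simp
        then have "y = x0" using y x0(1) by (intro cyc_inject) (auto simp: sign_seqs_def)
        then show ?thesis ..
      next
        assume "cyc y 0 = - 1"
        then have "cyc y i = cyc (neg x0) i" for i using alt[of i] cyc_neg[OF ne[OF x0(1)]] by simp
        then have "y = neg x0" using y x0(1) by (intro cyc_inject) (auto simp: sign_seqs_def)
        then show ?thesis ..
      qed
    qed
    have "(\<Sum>x\<in>?A. 1 / real (card (flexagon_rel `` {x}))) = real (card (?A // flexagon_rel))"
    proof (rule card_quotient_eq_sum[symmetric, OF _ equiv_flexagon_rel])
      show "flexagon_rel `` {x} \<subseteq> ?A" if "x \<in> ?A" for x
        using that flexagon_rel_invariant[of x _ n] flexagon_rel_cong[of x] by blast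
    qed (simp add: finite_sign_seqs)
    also have "?A // flexagon_rel = {flexagon_rel `` {x0}}"
    proof -
      have "flexagon_rel `` {neg x0} = flexagon_rel `` {x0}"
        by (simp add: flexagon_rel_image Un_commute)
      then have "flexagon_rel `` {x} = flexagon_rel `` {x0}" if "x \<in> ?A" for x
        using same[OF that] by (elim disjE) simp_all
      then show ?thesis using x0A unfolding quotient_def by blast
    qed
    finally show ?thesis using True by simp
  qed
qed

text \<open>Alternating sequences have sum 0 and pass the divisibility test, so their single class
  for even \<open>n\<close> has to be subtracted.\<close>

lemma H_eq_sum:
  assumes "n \<ge> 3"
  shows "real (H n) = (\<Sum>k | k \<le> n \<and> 3 dvd 2 * int k - int n. class_weight n k) - (if even n then 1 else 0)"
proof -
  let ?w = "\<lambda>x. 1 / real (card (flexagon_rel `` {x}))"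
  let ?T = "{x \<in> sign_seqs n. 3 dvd sum_list x}"
  let ?A = "{x \<in> sign_seqs n. rotate1 x = neg x}"
  have "{C \<in> sign_seqs n // flexagon_rel. \<exists>s\<in>C. obtainable s} = (?T - ?A) // flexagon_rel"
    using class_obtainable_iff[OF _ assms] unfolding quotient_def by blast
  then have "real (H n) = real (card ((?T - ?A) // flexagon_rel))" by (simp add: H_def)
  also have "\<dots> = (\<Sum>x\<in>?T - ?A. ?w x)"
  proof (rule card_quotient_eq_sum[OF _ equiv_flexagon_rel])
    show "flexagon_rel `` {x} \<subseteq> ?T - ?A" if "x \<in> ?T - ?A" for x
      using that flexagon_rel_invariant[of x _ n] flexagon_rel_cong[of x] by blast
  qed (simp add: finite_sign_seqs)
  also have "\<dots> = (\<Sum>x\<in>?T. ?w x) - (\<Sum>x\<in>?A. ?w x)"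
  proof (rule sum_diff)
    show "?A \<subseteq> ?T"
    proof
      fix x assume x: "x \<in> ?A"
      then have "sum_list x = - sum_list x" using sum_list_rotate[of 1 x] by (simp add: sum_list_neg)
      then show "x \<in> ?T" using x by simp
    qed
  qed (simp add: finite_sign_seqs)
  also have "(\<Sum>x\<in>?A. ?w x) = (if even n then 1 else 0)" using sum_alternating assms by simp
  also have "(\<Sum>x\<in>?T. ?w x) = (\<Sum>k | k \<le> n \<and> 3 dvd 2 * int k - int n. \<Sum>x | x \<in> ?T \<and> count_list x 1 = k. ?w x)"
    by (rule sum.group[symmetric])
      (use finite_sign_seqs count_list_le sum_list_count in auto)
  also have "\<dots> = (\<Sum>k | k \<le> n \<and> 3 dvd 2 * int k - int n. class_weight n k)"
    unfolding class_weight_def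
    by (intro sum.cong refl) (use sum_list_count in auto)
  finally show ?thesis .
qed

section \<open>Reindexing the numbers of ones to reach the closed formula\<close>

theorem mainTheorem2:
  fixes n :: nat
  assumes "n \<ge> 3"
  shows "real (H n) =
    (if odd n
     then (\<Sum>i = 0..nat \<lfloor>(real n - 2) / 6\<rfloor>. real (B n (nat \<lceil>real n / 2\<rceil> + 1 + 3 * i)))
     else - (1 / 2) * real (B n (n div 2)) + (1 / 2) * real (F n) - 1
          + (\<Sum>i = 0..nat \<lfloor>real n / 6\<rfloor>. real (B n (nat \<lceil>real n / 2\<rceil> + 3 * i))))"
proof -
  let ?hi = "{k. k \<le> n \<and> n < 2 * k \<and> 3 dvd 2 * int k - int n}"
  have H: "real (H n) = (if even n then real (B n (n div 2)) / 2 + real (F n) / 2 else 0)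
      + (\<Sum>k\<in>?hi. real (B n k)) - (if even n then 1 else 0)"
    using H_eq_sum[OF assms] sum_class_weight[of n] assms by simp
  show ?thesis
  proof (cases "even n")
    case False
    then obtain m where m: "n = 2 * m + 1" by (rule oddE)
    have ceil: "nat \<lceil>real n / 2\<rceil> = m + 1"
    proof -
      have "\<lceil>real n / 2\<rceil> = int m + 1" unfolding m by (rule ceiling_unique) auto
      then show ?thesis by simp
    qed
    have floor: "nat \<lfloor>(real n - 2) / 6\<rfloor> = (n - 2) div 6"
      using floor_divide_of_nat_eq[of "n - 2" 6, where 'a = real] assms by simp
    \<comment> \<open>Here \<open>2 * int k - int n\<close> is a positive odd multiple of 3, so the
      least candidate is \<open>m + 2\<close>. The bound \<open>k \<le> n\<close> reads
      \<open>6 * j \<le> n - 3\<close>, which for odd \<open>n\<close> is the same as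
      \<open>6 * j \<le> n - 2\<close>.\<close>
    have "?hi = (\<lambda>i. m + 1 + 1 + 3 * i) ` {0..(n - 2) div 6}"
    proof (intro equalityI subsetI)
      fix k assume "k \<in> ?hi"
      then have k: "k \<le> n" "n < 2 * k" "3 dvd 2 * int k - int n" by auto
      then have "\<exists>j. k = m + 1 + 1 + 3 * j" unfolding m by presburger
      then obtain j where j: "k = m + 1 + 1 + 3 * j" ..
      then have "6 * j \<le> n - 2" using k(1) m by linarith
      then have "j \<le> (n - 2) div 6" by linarith
      then show "k \<in> (\<lambda>i. m + 1 + 1 + 3 * i) ` {0..(n - 2) div 6}" using j by auto
    next
      fix k assume "k \<in> (\<lambda>i. m + 1 + 1 + 3 * i) ` {0..(n - 2) div 6}"
      then obtain j where j: "j \<le> (n - 2) div 6" "k = m + 1 + 1 + 3 * j" by auto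
      then have "6 * j \<le> n - 2" by linarith
      moreover have "2 * int k - int n = 3 * (1 + 2 * int j)" using j(2) m by simp
      ultimately show "k \<in> ?hi" using j(2) m assms by simp
    qed
    then have "(\<Sum>k\<in>?hi. real (B n k)) = (\<Sum>i = 0..(n - 2) div 6. real (B n (m + 1 + 1 + 3 * i)))"
      by (simp only:) (subst sum.reindex, auto simp: inj_on_def)
    then show ?thesis using H False by (simp only: ceil floor) simp
  next
    case True
    then obtain m where m: "n = 2 * m" by (rule evenE)
    have ceil: "nat \<lceil>real n / 2\<rceil> = m" using m by simp
    have floor: "nat \<lfloor>real n / 6\<rfloor> = n div 6"
      using floor_divide_of_nat_eq[of n 6, where 'a = real] by simp
    \<comment> \<open>The sum in the formula starts at the middle index \<open>m\<close>, which
      \<open>?hi\<close> excludes. Including the full \<open>B n m\<close> turns its coefficient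
      from one half into minus one half.\<close>
    have "insert m ?hi = (\<lambda>i. m + 3 * i) ` {0..n div 6}"
    proof (intro equalityI subsetI)
      fix k assume "k \<in> insert m ?hi"
      then have k: "k \<le> n" "n \<le> 2 * k" "3 dvd 2 * int k - int n" using m by auto
      then have "\<exists>j. k = m + 3 * j" unfolding m by presburger
      then obtain j where j: "k = m + 3 * j" ..
      then have "6 * j \<le> n" using k(1) m by linarith
      then have "j \<le> n div 6" by linarith
      then show "k \<in> (\<lambda>i. m + 3 * i) ` {0..n div 6}" using j by auto
    next
      fix k assume "k \<in> (\<lambda>i. m + 3 * i) ` {0..n div 6}"
      then obtain j where j: "j \<le> n div 6" "k = m + 3 * j" by auto
      then have "6 * j \<le> n" by linarith
      moreover have "2 * int k - int n = 3 * (2 * int j)" using j(2) m by simp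
      ultimately show "k \<in> insert m ?hi" using j(2) m by auto
    qed
    then have "(\<Sum>k\<in>insert m ?hi. real (B n k)) = (\<Sum>i = 0..n div 6. real (B n (m + 3 * i)))"
      by (simp only:) (subst sum.reindex, auto simp: inj_on_def)
    moreover have "(\<Sum>k\<in>insert m ?hi. real (B n k)) = real (B n m) + (\<Sum>k\<in>?hi. real (B n k))"
      using m by (intro sum.insert) auto
    moreover have "n div 2 = m" using m by simp
    ultimately show ?thesis unfolding ceil floor using H True by simp
  qed
qed

end
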